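(* Let $k$ be a field, let $B=kQ/I$ be a bound quiver algebra, let $F$ be a set of new arrows with no relative cycles, and let $B_F=kQ_F/\langle I\rangle_{kQ_F}$. Then $$HH_1(B_F)=HH_1(B),$$ where $=$ means canonical isomorphism of $k$-vector spaces.
   Context: A quiver $Q$ has a finite set of vertices $Q_0$, a finite set of arrows $Q_1$, and source and target maps $s,t:Q_1\to Q_0$. A path of length $n>0$ is a sequence of arrows $(a_n,\dots,a_1)$ with $s(a_{i+1})=t(a_i)$; its source is $s(a_1)$ and its target is $t(a_n)$; vertices are the paths of length $0$. $Q_n$ is the set of paths of length $n$. In the path algebra $kQ$ the product $\beta\alpha$ of two paths is their concatenation if $t(\alpha)=s(\beta)$, and $0$ otherwise; vertices are orthogonal idempotents. A bound quiver algebra is $B=kQ/I$ with $I$ a two-sided ideal which is admissible, i.e. $\langle Q_n\rangle\subset I\subset\langle Q_2\rangle$ for some $n\ge 2$. A set of new arrows is a finite set $F$ with two maps $s,t:F\to Q_0$. The quiver $Q_F$ has vertices $Q_0$ and arrows $Q_1\sqcup F$, with the evident source and target maps; $\langle I\rangle_{kQ_F}$ is the two-sided ideal of $kQ_F$ generated by $I$. A relative path of length $n>0$ is a sequence $\gamma=(a_n,\dots,a_1)$ of elements of $F$ such that $s(a_{i+1})\,B\,t(a_i)\neq 0$ for $i=1,\dots,n-1$; put $s(\gamma)=s(a_1)$, $t(\gamma)=t(a_n)$. A relative cycle is a relative path $\gamma$ with $s(\gamma)\,B\,t(\gamma)\neq 0$. $HH_n(A)=H_n(A,A)$ is the Hochschild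 homology of the algebra $A$ with coefficients in $A$. *)

theory Defs
  imports
    "HOL-Library.Poly_Mapping"
    "Graph_Theory.Graph_Theory"
    "HOL-Algebra.QuotRing"
    "HOL-Algebra.Module"
begin

text \<open>
  The ground field is a type \<open>'k\<close> of class \<open>field\<close>.  Vector spaces and (in general
  noncommutative) unital algebras over it are records of type \<open>('k, 'a) module\<close>, which carry ring
  operations together with a scalar multiplication.  For a mere vector space the fields
  \<open>mult\<close> and \<open>one\<close> are irrelevant.
\<close>

section \<open>Vector spaces, quotients, linear isomorphisms\<close>

text \<open>The free vector space on a type \<open>'s\<close> is \<open>'s \<Rightarrow>\<^sub>0 'k\<close>.\<close>

definition pm_scale :: "'k::field \<Rightarrow> ('s \<Rightarrow>\<^sub>0 'k) \<Rightarrow> ('s \<Rightarrow>\<^sub>0 'k)" where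
  "pm_scale c f = Poly_Mapping.map ((*) c) f"

lemma lookup_pm_scale: "Poly_Mapping.lookup (pm_scale c f) x = c * Poly_Mapping.lookup f x"
  by (simp add: pm_scale_def Poly_Mapping.map.rep_eq when_def)

interpretation pm: vector_space pm_scale
  by unfold_locales
    (auto intro!: poly_mapping_eqI simp: lookup_pm_scale lookup_add algebra_simps)

definition pm_extend :: "('s \<Rightarrow> ('t \<Rightarrow>\<^sub>0 'k::field)) \<Rightarrow> ('s \<Rightarrow>\<^sub>0 'k) \<Rightarrow> ('t \<Rightarrow>\<^sub>0 'k)" where
  "pm_extend g f = (\<Sum>x\<in>Poly_Mapping.keys f. pm_scale (Poly_Mapping.lookup f x) (g x))"

lemma pm_extend_superset:
  assumes "finite S" "Poly_Mapping.keys f \<subseteq> S"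
  shows "pm_extend g f = (\<Sum>x\<in>S. pm_scale (Poly_Mapping.lookup f x) (g x))"
  unfolding pm_extend_def
  by (rule sum.mono_neutral_left) (use assms in \<open>auto simp: in_keys_iff\<close>)

lemma pm_extend_add: "pm_extend g (f + f') = pm_extend g f + pm_extend g f'"
proof -
  let ?S = "Poly_Mapping.keys f \<union> Poly_Mapping.keys f'"
  have "Poly_Mapping.keys (f + f') \<subseteq> ?S" by (rule keys_add)
  then show ?thesis
    by (subst (1 2 3) pm_extend_superset[of ?S])
      (auto simp: lookup_add pm.scale_left_distrib sum.distrib)
qed

lemma pm_extend_scale: "pm_extend g (pm_scale c f) = pm_scale c (pm_extend g f)"
proof -
  have "Poly_Mapping.keys (pm_scale c f) \<subseteq> Poly_Mapping.keys f"
    by (auto simp: in_keys_iff lookup_pm_scale)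
  then show ?thesis
    by (subst pm_extend_superset[of "Poly_Mapping.keys f"])
      (auto simp: lookup_pm_scale pm_extend_def pm.scale_sum_right)
qed

lemma pm_extend_0 [simp]: "pm_extend g 0 = 0"
  by (simp add: pm_extend_def)

lemma pm_extend_sum: "pm_extend g (sum h S) = (\<Sum>x\<in>S. pm_extend g (h x))"
  by (induction S rule: infinite_finite_induct) (auto simp: pm_extend_add)

lemma pm_extend_single [simp]: "pm_extend g (Poly_Mapping.single x c) = pm_scale c (g x)"
  by (subst pm_extend_superset[of "{x}"]) auto

lemma pm_extend_extend: "pm_extend g (pm_extend h f) = pm_extend (\<lambda>x. pm_extend g (h x)) f"
  by (simp add: pm_extend_def[of h] pm_extend_sum pm_extend_scale)
    (simp add: pm_extend_def[of "\<lambda>x. pm_extend g (h x)"])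

lemma pm_extend_cong:
  "(\<And>x. x \<in> Poly_Mapping.keys f \<Longrightarrow> g x = h x) \<Longrightarrow> pm_extend g f = pm_extend h f"
  by (simp add: pm_extend_def)

lemma pm_extend_fun_add: "pm_extend (\<lambda>x. g x + h x) f = pm_extend g f + pm_extend h f"
  by (simp add: pm_extend_def pm.scale_right_distrib sum.distrib)

lemma pm_extend_id: "pm_extend (\<lambda>x. Poly_Mapping.single x 1) f = f"
proof -
  have "pm_scale c (Poly_Mapping.single x 1) = Poly_Mapping.single x c" for c :: 'b and x :: 'a
    by (auto intro!: poly_mapping_eqI simp: lookup_pm_scale lookup_single when_def)
  then have "Poly_Mapping.lookup (pm_extend (\<lambda>x. Poly_Mapping.single x 1) f) y = Poly_Mapping.lookup f y" for y
    by (auto simp: pm_extend_def lookup_sum lookup_single when_def in_keys_iff sum.delta if_distrib cong: if_cong)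
  then show ?thesis by (rule poly_mapping_eqI)
qed

lemma keys_pm_extend:
  assumes "\<And>x. x \<in> Poly_Mapping.keys f \<Longrightarrow> Poly_Mapping.keys (g x) \<subseteq> S"
  shows "Poly_Mapping.keys (pm_extend g f) \<subseteq> S"
proof -
  have "Poly_Mapping.keys (pm_scale c (g x)) \<subseteq> Poly_Mapping.keys (g x)" for c x
    by (auto simp: in_keys_iff lookup_pm_scale)
  then show ?thesis
    unfolding pm_extend_def using assms keys_sum by (smt (verit) UN_E subset_iff)
qed

definition free_space :: "'s set \<Rightarrow> ('k::field, 's \<Rightarrow>\<^sub>0 'k) module" where
  "free_space S = \<lparr>carrier = {f. Poly_Mapping.keys f \<subseteq> S}, mult = undefined, one = undefined,
     zero = 0, add = (+), smult = pm_scale\<rparr>"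

text \<open>
  The map induced on cosets by a map \<open>g\<close>, with values in the cosets of \<open>N'\<close> in \<open>M'\<close>:  if
  \<open>g\<close> is additive and maps \<open>N\<close> into \<open>N'\<close>, then \<open>N + x\<close> is sent to \<open>N' + g x\<close>.
\<close>

definition coset_map :: "('b, 'm) ring_scheme \<Rightarrow> 'b set \<Rightarrow> ('a \<Rightarrow> 'b) \<Rightarrow> 'a set \<Rightarrow> 'b set" where
  "coset_map M' N' g X = (\<Union>x\<in>X. N' +>\<^bsub>M'\<^esub> g x)"

text \<open>
  The quotient by a two-sided ideal (of an algebra) or by a subspace (of a vector space):
  \<open>M Quot N\<close> with the induced scalar multiplication.
\<close>

definition quotient :: "('k, 'a) module \<Rightarrow> 'a set \<Rightarrow> ('k, 'a set) module" where
  "quotient M N = \<lparr>carrier = carrier (M Quot N), mult = mult (M Quot N), one = one (M Quot N),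
     zero = zero (M Quot N), add = add (M Quot N),
     smult = (\<lambda>c. coset_map M N (\<lambda>x. c \<odot>\<^bsub>M\<^esub> x))\<rparr>"

definition linear_iso :: "('k, 'a) module \<Rightarrow> ('k, 'b) module \<Rightarrow> ('a \<Rightarrow> 'b) set" where
  "linear_iso V W = {h \<in> iso (add_monoid V) (add_monoid W).
     \<forall>c. \<forall>x\<in>carrier V. h (c \<odot>\<^bsub>V\<^esub> x) = c \<odot>\<^bsub>W\<^esub> h x}"

section \<open>Hochschild homology\<close>

text \<open>
  The tensor power \<open>A \<otimes> \<dots> \<otimes> A\<close> (\<open>n\<close> factors, over \<open>'k\<close>) is the free vector space on
  the lists of length \<open>n\<close> modulo the multilinearity relations; the coset of
  \<open>single [x\<^sub>1, \<dots>, x\<^sub>n] 1\<close> is the pure tensor.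
\<close>

definition tensor_lists :: "('k::field, 'a) module \<Rightarrow> nat \<Rightarrow> 'a list set" where
  "tensor_lists A n = {xs. length xs = n \<and> set xs \<subseteq> carrier A}"

definition tensor_rel :: "('k::field, 'a) module \<Rightarrow> nat \<Rightarrow> ('a list \<Rightarrow>\<^sub>0 'k) set" where
  "tensor_rel A n = pm.span
     ({Poly_Mapping.single (xs[i := x \<oplus>\<^bsub>A\<^esub> y]) 1 - Poly_Mapping.single (xs[i := x]) 1
         - Poly_Mapping.single (xs[i := y]) 1 | xs i x y.
         xs \<in> tensor_lists A n \<and> i < n \<and> x \<in> carrier A \<and> y \<in> carrier A}
      \<union> {Poly_Mapping.single (xs[i := c \<odot>\<^bsub>A\<^esub> x]) 1
         - pm_scale c (Poly_Mapping.single (xs[i := x]) 1) | xs i c x.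
         xs \<in> tensor_lists A n \<and> i < n \<and> x \<in> carrier A})"

definition tensor_power ::
    "('k::field, 'a) module \<Rightarrow> nat \<Rightarrow> ('k, ('a list \<Rightarrow>\<^sub>0 'k) set) module" where
  "tensor_power A n = quotient (free_space (tensor_lists A n)) (tensor_rel A n)"

text \<open>
  The faces of \<open>a\<^sub>0 \<otimes> \<dots> \<otimes> a\<^sub>n\<close>: for \<open>i < n\<close> multiply \<open>a\<^sub>i\<close> and \<open>a\<^bsub>i+1\<^esub>\<close>; the last
  one is \<open>a\<^sub>n a\<^sub>0 \<otimes> a\<^sub>1 \<otimes> \<dots> \<otimes> a\<^bsub>n-1\<^esub>\<close>.
\<close>

definition hoch_face :: "('k::field, 'a) module \<Rightarrow> nat \<Rightarrow> 'a list \<Rightarrow> 'a list" where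
  "hoch_face A i xs =
     (if Suc i < length xs
      then take i xs @ [xs ! i \<otimes>\<^bsub>A\<^esub> xs ! Suc i] @ drop (Suc (Suc i)) xs
      else [last xs \<otimes>\<^bsub>A\<^esub> hd xs] @ tl (butlast xs))"

definition hoch_boundary ::
    "('k::field, 'a) module \<Rightarrow> nat \<Rightarrow> 'a list \<Rightarrow> ('a list \<Rightarrow>\<^sub>0 'k)" where
  "hoch_boundary A n xs =
     (if n = 0 then 0
      else \<Sum>i\<le>n. pm_scale ((- 1) ^ i) (Poly_Mapping.single (hoch_face A i xs) 1))"

definition hoch_chains ::
    "('k::field, 'a) module \<Rightarrow> nat \<Rightarrow> ('k, ('a list \<Rightarrow>\<^sub>0 'k) set) module" where
  "hoch_chains A n = tensor_power A (Suc n)"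

text \<open>
  The differential from \<open>n\<close>-chains to \<open>(n - 1)\<close>-chains.  It vanishes for \<open>n = 0\<close>, where
  the complex ends (the nominal target \<open>tensor_power A 0\<close> plays no role).
\<close>

definition hoch_d ::
    "('k::field, 'a) module \<Rightarrow> nat \<Rightarrow> ('a list \<Rightarrow>\<^sub>0 'k) set \<Rightarrow> ('a list \<Rightarrow>\<^sub>0 'k) set" where
  "hoch_d A n =
     coset_map (free_space (tensor_lists A n)) (tensor_rel A n) (pm_extend (hoch_boundary A n))"

definition hoch_cycles ::
    "('k::field, 'a) module \<Rightarrow> nat \<Rightarrow> ('k, ('a list \<Rightarrow>\<^sub>0 'k) set) module" where
  "hoch_cycles A n = (hoch_chains A n)
     \<lparr>carrier := {X \<in> carrier (hoch_chains A n). hoch_d A n X = \<zero>\<^bsub>tensor_power A n\<^esub>}\<rparr>"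

definition hoch_boundaries ::
    "('k::field, 'a) module \<Rightarrow> nat \<Rightarrow> ('a list \<Rightarrow>\<^sub>0 'k) set set" where
  "hoch_boundaries A n = hoch_d A (Suc n) ` carrier (hoch_chains A (Suc n))"

definition HH ::
    "nat \<Rightarrow> ('k::field, 'a) module \<Rightarrow> ('k, ('a list \<Rightarrow>\<^sub>0 'k) set set) module" where
  "HH n A = quotient (hoch_cycles A n) (hoch_boundaries A n)"

text \<open>
  Functoriality for an algebra homomorphism \<open>\<phi>\<close> from \<open>A\<close> to \<open>A'\<close>; the source
  algebra enters only through the argument.
\<close>

definition hoch_chain_map :: "nat \<Rightarrow> ('k::field, 'b) module \<Rightarrow> ('a \<Rightarrow> 'b) \<Rightarrow>
    ('a list \<Rightarrow>\<^sub>0 'k) set \<Rightarrow> ('b list \<Rightarrow>\<^sub>0 'k) set" where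
  "hoch_chain_map n A' \<phi> =
     coset_map (free_space (tensor_lists A' (Suc n))) (tensor_rel A' (Suc n))
       (pm_extend (\<lambda>xs. Poly_Mapping.single (map \<phi> xs) 1))"

definition HH_map :: "nat \<Rightarrow> ('k::field, 'b) module \<Rightarrow> ('a \<Rightarrow> 'b) \<Rightarrow>
    ('a list \<Rightarrow>\<^sub>0 'k) set set \<Rightarrow> ('b list \<Rightarrow>\<^sub>0 'k) set set" where
  "HH_map n A' \<phi> = coset_map (hoch_cycles A' n) (hoch_boundaries A' n) (hoch_chain_map n A' \<phi>)"

section \<open>Quivers and path algebras\<close>

text \<open>
  A quiver is a finite directed multigraph (\<^locale>\<open>fin_digraph\<close>), loops allowed.  The path
  \<open>(a\<^sub>n, \<dots>, a\<^sub>1)\<close> is encoded by its source together with the list \<open>[a\<^sub>1, \<dots>, a\<^sub>n]\<close>; the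
  vertex \<open>v\<close>, as a path of length 0, is \<open>(v, [])\<close>.
\<close>

type_synonym ('v, 'e) path = "'v \<times> 'e list"

definition paths :: "('v, 'e) pre_digraph \<Rightarrow> ('v, 'e) path set" where
  "paths Q = {(u, p). \<exists>v. pre_digraph.awalk Q u p v}"

definition path_target :: "('v, 'e) pre_digraph \<Rightarrow> ('v, 'e) path \<Rightarrow> 'v" where
  "path_target Q \<alpha> = pre_digraph.awlast Q (fst \<alpha>) (snd \<alpha>)"

definition paths_of_length :: "('v, 'e) pre_digraph \<Rightarrow> nat \<Rightarrow> ('v, 'e) path set" where
  "paths_of_length Q n = {\<alpha> \<in> paths Q. length (snd \<alpha>) = n}"

definition path_elem :: "('v, 'e) path \<Rightarrow> (('v, 'e) path \<Rightarrow>\<^sub>0 'k::field)" where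
  "path_elem \<alpha> = Poly_Mapping.single \<alpha> 1"

text \<open>The product \<open>\<beta>\<alpha>\<close> of paths is \<open>\<alpha>\<close> followed by \<open>\<beta>\<close>.\<close>

definition path_mult ::
    "('v, 'e) pre_digraph \<Rightarrow> ('v, 'e) path \<Rightarrow> ('v, 'e) path \<Rightarrow> (('v, 'e) path \<Rightarrow>\<^sub>0 'k::field)" where
  "path_mult Q \<beta> \<alpha> =
     (if path_target Q \<alpha> = fst \<beta> then path_elem (fst \<alpha>, snd \<alpha> @ snd \<beta>) else 0)"

definition path_algebra ::
    "('v, 'e) pre_digraph \<Rightarrow> ('k::field, ('v, 'e) path \<Rightarrow>\<^sub>0 'k) module" where
  "path_algebra Q = \<lparr>carrier = {f. Poly_Mapping.keys f \<subseteq> paths Q},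
     mult = (\<lambda>f g. pm_extend (\<lambda>\<beta>. pm_extend (\<lambda>\<alpha>. path_mult Q \<beta> \<alpha>) g) f),
     one = (\<Sum>v\<in>verts Q. path_elem (v, [])),
     zero = 0, add = (+), smult = pm_scale\<rparr>"

text \<open>\<^locale>\<open>ideal\<close> presupposes a ring, so this is needed for the hypothesis below to be satisfiable.\<close>

lemma path_target_append: "path_target Q (u, p @ q) = path_target Q (path_target Q (u, p), q)"
  unfolding path_target_def by (induction p arbitrary: u) (auto simp: pre_digraph.awalk_verts.simps pre_digraph.awalk_verts_non_Nil)

lemma paths_mult:
  assumes "wf_digraph Q" "\<alpha> \<in> paths Q" "\<beta> \<in> paths Q" "path_target Q \<alpha> = fst \<beta>"
  shows "(fst \<alpha>, snd \<alpha> @ snd \<beta>) \<in> paths Q"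
  using assms wf_digraph.awalk_appendI[OF assms(1)] wf_digraph.awlast_if_cas[OF assms(1)]
  unfolding paths_def path_target_def by (fastforce simp: pre_digraph.awalk_def)

lemma ring_path_algebra:
  assumes "fin_digraph Q"
  shows "ring (path_algebra Q :: ('k::field, ('v, 'e) path \<Rightarrow>\<^sub>0 'k) module)"
proof -
  interpret fin_digraph Q by fact
  have wf: "wf_digraph Q" by unfold_locales
  let ?m = "\<lambda>f g. pm_extend (\<lambda>\<beta>. pm_extend (\<lambda>\<alpha>. path_mult Q \<beta> \<alpha>) g) (f :: ('v, 'e) path \<Rightarrow>\<^sub>0 'k)"
  have assoc_basis: "pm_extend (\<lambda>\<beta>. pm_extend (\<lambda>\<alpha>. path_mult Q \<beta> \<alpha>) h) (path_mult Q b a)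
     = pm_extend (\<lambda>\<alpha>. pm_extend (\<lambda>\<gamma>. path_mult Q b \<gamma>) (path_mult Q a \<alpha>)) h"
    for a b and h :: "('v, 'e) path \<Rightarrow>\<^sub>0 'k"
  proof (cases "path_target Q a = fst b")
    case True
    then show ?thesis
      by (auto simp: path_mult_def path_elem_def path_target_append intro!: pm_extend_cong)
  next
    case False
    have "path_target Q (fst \<alpha>, snd \<alpha> @ snd a) = path_target Q a" if "path_target Q \<alpha> = fst a" for \<alpha>
      using that path_target_append by (metis prod.collapse)
    with False show ?thesis
      by (subst pm_extend_cong[of h _ "\<lambda>_. 0"]) (auto simp: path_mult_def path_elem_def pm_extend_def)
  qed
  have assoc: "?m (?m f g) h = ?m f (?m g h)" for f g h
    by (simp add: pm_extend_extend assoc_basis)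
  have closed: "Poly_Mapping.keys (?m f g) \<subseteq> paths Q"
    if "Poly_Mapping.keys f \<subseteq> paths Q" "Poly_Mapping.keys g \<subseteq> paths Q" for f g
    using that by (intro keys_pm_extend) (auto simp: path_mult_def path_elem_def intro!: paths_mult wf)
  have vpath: "v \<in> verts Q \<Longrightarrow> (v, []) \<in> paths Q" for v
    by (auto simp: paths_def pre_digraph.awalk_def pre_digraph.cas.simps)
  have one_closed: "Poly_Mapping.keys (\<Sum>v\<in>verts Q. path_elem (v, []) :: ('v, 'e) path \<Rightarrow>\<^sub>0 'k) \<subseteq> paths Q"
    using keys_sum vpath unfolding path_elem_def by (smt (verit) UN_E keys_single singletonD subset_iff empty_iff)
  have pv: "fst a \<in> verts Q \<and> path_target Q a \<in> verts Q" if "a \<in> paths Q" for a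
    using that awlast_in_verts awlast_if_cas unfolding paths_def path_target_def
    by (auto simp: pre_digraph.awalk_def)
  have l_one: "?m (\<Sum>v\<in>verts Q. path_elem (v, [])) f = f" if f: "Poly_Mapping.keys f \<subseteq> paths Q" for f
  proof -
    have "?m (\<Sum>v\<in>verts Q. path_elem (v, [])) f = (\<Sum>v\<in>verts Q. pm_extend (path_mult Q (v, [])) f)"
      by (simp add: pm_extend_sum path_elem_def)
    also have "\<dots> = pm_extend (\<lambda>\<alpha>. \<Sum>v\<in>verts Q. path_mult Q (v, []) \<alpha>) f"
      by (simp add: pm_extend_def pm.scale_sum_right sum.swap[of _ "verts Q"])
    also have "\<dots> = pm_extend (\<lambda>\<alpha>. Poly_Mapping.single \<alpha> 1) f"
      using f pv by (intro pm_extend_cong) (auto simp: path_mult_def path_elem_def sum.delta')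
    finally show ?thesis by (simp add: pm_extend_id)
  qed
  have r_one: "?m f (\<Sum>v\<in>verts Q. path_elem (v, [])) = f" if f: "Poly_Mapping.keys f \<subseteq> paths Q" for f
  proof -
    have "?m f (\<Sum>v\<in>verts Q. path_elem (v, [])) = pm_extend (\<lambda>\<beta>. \<Sum>v\<in>verts Q. path_mult Q \<beta> (v, [])) f"
      by (simp add: pm_extend_sum path_elem_def)
    also have "\<dots> = pm_extend (\<lambda>\<alpha>. Poly_Mapping.single \<alpha> 1) f"
      using f pv by (intro pm_extend_cong)
       (auto simp: path_mult_def path_elem_def sum.delta path_target_def pre_digraph.awalk_verts.simps)
    finally show ?thesis by (simp add: pm_extend_id)
  qed
  have kadd: "Poly_Mapping.keys (f + g) \<subseteq> paths Q"
    if "Poly_Mapping.keys f \<subseteq> paths Q" "Poly_Mapping.keys g \<subseteq> paths Q" for f g :: "('v, 'e) path \<Rightarrow>\<^sub>0 'k"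
    using keys_add[of f g] that by blast
  show ?thesis
  proof (rule ringI)
    show "abelian_group (path_algebra Q :: ('k, ('v, 'e) path \<Rightarrow>\<^sub>0 'k) module)"
      by (rule abelian_groupI)
        (auto simp: path_algebra_def add_ac kadd[THEN subsetD] intro!: exI[of _ "- _"] bexI[of _ "- _"])
    show "monoid (path_algebra Q :: ('k, ('v, 'e) path \<Rightarrow>\<^sub>0 'k) module)"
      by (rule monoidI)
        (use closed one_closed l_one r_one assoc in \<open>simp_all add: path_algebra_def\<close>)
  qed (simp_all add: path_algebra_def pm_extend_add pm_extend_fun_add)
qed

definition admissible ::
    "('v, 'e) pre_digraph \<Rightarrow> (('v, 'e) path \<Rightarrow>\<^sub>0 'k::field) set \<Rightarrow> bool" where
  "admissible Q I \<longleftrightarrow> ideal I (path_algebra Q) \<and>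
     (\<exists>n\<ge>2. Idl\<^bsub>path_algebra Q\<^esub> (path_elem ` paths_of_length Q n) \<subseteq> I) \<and>
     I \<subseteq> Idl\<^bsub>path_algebra Q\<^esub> (path_elem ` paths_of_length Q 2)"

definition quiver_algebra :: "('v, 'e) pre_digraph \<Rightarrow> (('v, 'e) path \<Rightarrow>\<^sub>0 'k::field) set \<Rightarrow>
    ('k, (('v, 'e) path \<Rightarrow>\<^sub>0 'k) set) module" where
  "quiver_algebra Q I = quotient (path_algebra Q) I"

definition vertex_idem :: "('v, 'e) pre_digraph \<Rightarrow> (('v, 'e) path \<Rightarrow>\<^sub>0 'k::field) set \<Rightarrow> 'v \<Rightarrow>
    (('v, 'e) path \<Rightarrow>\<^sub>0 'k) set" where
  "vertex_idem Q I v = I +>\<^bsub>path_algebra Q\<^esub> path_elem (v, [])"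

text \<open>The subspace \<open>x B y\<close> of \<open>B = kQ/I\<close> for vertices \<open>x\<close>, \<open>y\<close>.\<close>

definition corner :: "('v, 'e) pre_digraph \<Rightarrow> (('v, 'e) path \<Rightarrow>\<^sub>0 'k::field) set \<Rightarrow> 'v \<Rightarrow> 'v \<Rightarrow>
    (('v, 'e) path \<Rightarrow>\<^sub>0 'k) set set" where
  "corner Q I x y =
     {vertex_idem Q I x \<otimes>\<^bsub>quiver_algebra Q I\<^esub> b \<otimes>\<^bsub>quiver_algebra Q I\<^esub> vertex_idem Q I y | b.
        b \<in> carrier (quiver_algebra Q I)}"

section \<open>Adding new arrows\<close>

definition new_arrows ::
    "('v, 'e) pre_digraph \<Rightarrow> 'f set \<Rightarrow> ('f \<Rightarrow> 'v) \<Rightarrow> ('f \<Rightarrow> 'v) \<Rightarrow> bool" where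
  "new_arrows Q F sF tF \<longleftrightarrow> finite F \<and> sF ` F \<subseteq> verts Q \<and> tF ` F \<subseteq> verts Q"

definition add_arrows :: "('v, 'e) pre_digraph \<Rightarrow> 'f set \<Rightarrow> ('f \<Rightarrow> 'v) \<Rightarrow> ('f \<Rightarrow> 'v) \<Rightarrow>
    ('v, 'e + 'f) pre_digraph" where
  "add_arrows Q F sF tF = \<lparr>verts = verts Q, arcs = Inl ` arcs Q \<union> Inr ` F,
     tail = case_sum (tail Q) sF, head = case_sum (head Q) tF\<rparr>"

definition path_incl ::
    "(('v, 'e) path \<Rightarrow>\<^sub>0 'k::field) \<Rightarrow> (('v, 'e + 'f) path \<Rightarrow>\<^sub>0 'k)" where
  "path_incl = pm_extend (\<lambda>(u, p). path_elem (u, map Inl p))"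

definition ext_ideal :: "('v, 'e) pre_digraph \<Rightarrow> (('v, 'e) path \<Rightarrow>\<^sub>0 'k::field) set \<Rightarrow>
    'f set \<Rightarrow> ('f \<Rightarrow> 'v) \<Rightarrow> ('f \<Rightarrow> 'v) \<Rightarrow> (('v, 'e + 'f) path \<Rightarrow>\<^sub>0 'k) set" where
  "ext_ideal Q I F sF tF = Idl\<^bsub>path_algebra (add_arrows Q F sF tF)\<^esub> (path_incl ` I)"

definition ext_algebra :: "('v, 'e) pre_digraph \<Rightarrow> (('v, 'e) path \<Rightarrow>\<^sub>0 'k::field) set \<Rightarrow>
    'f set \<Rightarrow> ('f \<Rightarrow> 'v) \<Rightarrow> ('f \<Rightarrow> 'v) \<Rightarrow> ('k, (('v, 'e + 'f) path \<Rightarrow>\<^sub>0 'k) set) module" where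
  "ext_algebra Q I F sF tF = quiver_algebra (add_arrows Q F sF tF) (ext_ideal Q I F sF tF)"

text \<open>The canonical algebra map from \<open>kQ/I\<close> to \<open>kQ\<^sub>F/\<langle>I\<rangle>\<close>.\<close>

definition ext_map :: "('v, 'e) pre_digraph \<Rightarrow> (('v, 'e) path \<Rightarrow>\<^sub>0 'k::field) set \<Rightarrow>
    'f set \<Rightarrow> ('f \<Rightarrow> 'v) \<Rightarrow> ('f \<Rightarrow> 'v) \<Rightarrow>
    (('v, 'e) path \<Rightarrow>\<^sub>0 'k) set \<Rightarrow> (('v, 'e + 'f) path \<Rightarrow>\<^sub>0 'k) set" where
  "ext_map Q I F sF tF =
     coset_map (path_algebra (add_arrows Q F sF tF)) (ext_ideal Q I F sF tF) path_incl"

text \<open>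
  As for paths, the relative path \<open>(a\<^sub>n, \<dots>, a\<^sub>1)\<close> is encoded as the list \<open>[a\<^sub>1, \<dots>, a\<^sub>n]\<close>.
\<close>

definition relative_path :: "('v, 'e) pre_digraph \<Rightarrow> (('v, 'e) path \<Rightarrow>\<^sub>0 'k::field) set \<Rightarrow>
    'f set \<Rightarrow> ('f \<Rightarrow> 'v) \<Rightarrow> ('f \<Rightarrow> 'v) \<Rightarrow> 'f list \<Rightarrow> bool" where
  "relative_path Q I F sF tF as \<longleftrightarrow> as \<noteq> [] \<and> set as \<subseteq> F \<and>
     (\<forall>i. Suc i < length as \<longrightarrow>
        corner Q I (sF (as ! Suc i)) (tF (as ! i)) \<noteq> {\<zero>\<^bsub>quiver_algebra Q I\<^esub>})"

definition relative_cycle :: "('v, 'e) pre_digraph \<Rightarrow> (('v, 'e) path \<Rightarrow>\<^sub>0 'k::field) set \<Rightarrow>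
    'f set \<Rightarrow> ('f \<Rightarrow> 'v) \<Rightarrow> ('f \<Rightarrow> 'v) \<Rightarrow> 'f list \<Rightarrow> bool" where
  "relative_cycle Q I F sF tF as \<longleftrightarrow> relative_path Q I F sF tF as \<and>
     corner Q I (sF (hd as)) (tF (last as)) \<noteq> {\<zero>\<^bsub>quiver_algebra Q I\<^esub>}"

end

theory Submission
  imports Defs
begin

text \<open>
Write \<open>A\<close> for the algebra \<open>B\<^sub>F\<close>.  Sending every path through a new arrow to \<open>0\<close> is an algebra map
\<open>\<pi>\<close> from \<open>A\<close> to \<open>B\<close> that is left inverse to the canonical map \<open>\<phi>\<close>, so the map induced by \<open>\<phi>\<close> on
\<open>HH\<^sub>1\<close> has a left inverse.  What has to be shown is that every 1-cycle \<open>f\<close> of \<open>A\<close> is homologous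
to \<open>\<phi> \<pi> f\<close>.

For this it suffices to have a linear map \<open>h\<close> from \<open>A\<close> to \<open>A \<otimes> A\<close> such that, up to boundaries,
\<open>a \<otimes> b - \<phi> \<pi> a \<otimes> \<phi> \<pi> b = h (ab) - h (ba)\<close> for all \<open>a\<close> and \<open>b\<close>: the right hand side is
\<open>h\<close> applied to the boundary of \<open>a \<otimes> b\<close>, and this vanishes on cycles (lemma \<open>HH1_retract_iso\<close>).  The map
\<open>h\<close> cuts a path at its first new arrow.  If \<open>\<alpha> = \<alpha>' \<alpha>\<^sub>0\<close>, where \<open>\<alpha>\<^sub>0\<close> is the longest initial
segment without new arrows and \<open>\<alpha>'\<close> is not a vertex, then \<open>h \<alpha> = \<alpha>' \<otimes> \<alpha>\<^sub>0\<close>; a path without new arrows goes to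
\<open>0\<close>.  A relation from \<open>I\<close> inside a path contains no new arrow, hence lies on one side of the cut;
therefore \<open>h\<close> is defined on \<open>A\<close> (lemma \<open>cut_J\<close>).

The displayed identity is verified as follows.  Up to boundaries neither side changes when
\<open>a \<otimes> bc\<close> is replaced by \<open>ab \<otimes> c + ca \<otimes> b\<close>; hence the elements \<open>b\<close> for which the
identity holds with every \<open>a\<close> form a subalgebra (lemma \<open>homotopy_error_mult\<close>), and only vertices and
arrows \<open>b\<close> remain.
If \<open>a\<close> and \<open>b\<close> both come from \<open>B\<close>, both sides vanish.
If \<open>b\<close> comes from \<open>B\<close> and \<open>a = \<alpha>' \<alpha>\<^sub>0\<close> passes through a new arrow, then
\<open>h (ab) - h (ba) = \<alpha>' \<otimes> \<alpha>\<^sub>0 b - b \<alpha>' \<otimes> \<alpha>\<^sub>0\<close>, and this differs from \<open>a \<otimes> b\<close> by the boundary of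
\<open>\<alpha>' \<otimes> \<alpha>\<^sub>0 \<otimes> b\<close> (lemma \<open>err_incl\<close>).
If \<open>b = x\<close> is a new arrow from \<open>s\<close> to \<open>t\<close>, then \<open>x = e\<^sub>t x e\<^sub>s\<close>, and the same rule reduces
\<open>a \<otimes> x\<close> to \<open>e\<^sub>s a e\<^sub>t \<otimes> x\<close> and terms whose second factor is a vertex.  Here the hypothesis on \<open>F\<close>
enters: a path from \<open>t\<close> to \<open>s\<close> that is nonzero in \<open>A\<close> would be closed by \<open>x\<close> to a relative cycle, so
\<open>e\<^sub>s A e\<^sub>t = 0\<close> (lemmas \<open>return_path_zero\<close> and \<open>err_new_arrow\<close>).

Chains are handled through representatives in free vector spaces.  Accordingly maps into a tensor
power are maps into a free space that are linear modulo the multilinearity relations.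
\<close>

section \<open>Quotients of groups with scalar multiplication\<close>

text \<open>
Abelian groups with additive endomorphisms indexed by the scalars: the structure that is inherited by
quotients, kernels and images.
\<close>

locale operator_group = abelian_group V for V :: "('k::field, 'a) module" (structure) +
  assumes smult_closed [simp, intro]: "x \<in> carrier V \<Longrightarrow> c \<odot> x \<in> carrier V"
    and smult_add: "x \<in> carrier V \<Longrightarrow> y \<in> carrier V \<Longrightarrow> c \<odot> (x \<oplus> y) = c \<odot> x \<oplus> c \<odot> y"

definition additive_map :: "('k::field, 'a) module \<Rightarrow> ('k, 'b) module \<Rightarrow> ('a \<Rightarrow> 'b) \<Rightarrow> bool" where
  "additive_map V W g \<longleftrightarrow>
     (\<forall>x\<in>carrier V. g x \<in> carrier W) \<and>
     (\<forall>x\<in>carrier V. \<forall>y\<in>carrier V. g (x \<oplus>\<^bsub>V\<^esub> y) = g x \<oplus>\<^bsub>W\<^esub> g y)"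

definition operator_hom :: "('k::field, 'a) module \<Rightarrow> ('k, 'b) module \<Rightarrow> ('a \<Rightarrow> 'b) \<Rightarrow> bool" where
  "operator_hom V W g \<longleftrightarrow>
     additive_map V W g \<and>
     (\<forall>c. \<forall>x\<in>carrier V. g (c \<odot>\<^bsub>V\<^esub> x) = c \<odot>\<^bsub>W\<^esub> g x)"

locale operator_subgroup = operator_group V + additive_subgroup N V
  for N and V :: "('k::field, 'a) module" (structure) +
  assumes smult_sub: "x \<in> N \<Longrightarrow> c \<odot> x \<in> N"
begin

sublocale abelian_subgroup N V
  by (rule abelian_subgroupI3) (rule additive_subgroup_axioms, rule abelian_group_axioms)

lemma coset_eq_iff:
  assumes "x \<in> carrier V" "y \<in> carrier V"
  shows "N +> x = N +> y \<longleftrightarrow> x \<ominus> y \<in> N"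
  using assms a_rcos_module_minus[OF _ assms(2,1)] a_repr_independence' a_rcos_self
  by (metis abelian_group_axioms a_repr_independenceD ring.ring_simprules(1) a_rcos_module minus_eq)

lemma coset_eq_self_iff:
  assumes "x \<in> carrier V"
  shows "N +> x = N \<longleftrightarrow> x \<in> N"
  using assms a_coset_join1 a_coset_join2 a_subgroup by blast

lemma quotient_carrier: "carrier (quotient V N) = (\<lambda>x. N +> x) ` carrier V"
  by (auto simp: quotient_def FactRing_def A_RCOSETS_def')

lemma quotient_add:
  assumes "x \<in> carrier V" "y \<in> carrier V"
  shows "(N +> x) \<oplus>\<^bsub>quotient V N\<^esub> (N +> y) = N +> (x \<oplus> y)"
  using assms a_rcos_sum by (simp add: quotient_def FactRing_def)

lemma quotient_zero: "\<zero>\<^bsub>quotient V N\<^esub> = N"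
  by (simp add: quotient_def FactRing_def)

lemma coset_map_eq:
  assumes W: "operator_subgroup N' W" and g: "additive_map V W g"
    and N: "\<And>x. x \<in> N \<Longrightarrow> g x \<in> N'" and x: "x \<in> carrier V"
  shows "coset_map W N' g (N +> x) = N' +>\<^bsub>W\<^esub> g x"
proof -
  interpret W: operator_subgroup N' W by fact
  have "N' +>\<^bsub>W\<^esub> g y = N' +>\<^bsub>W\<^esub> g x" if y: "y \<in> N +> x" for y
  proof -
    obtain n where n: "n \<in> N" "y = n \<oplus> x"
      using y by (auto simp: a_r_coset_def')
    then have nc: "n \<in> carrier V" using a_subset by auto
    then have "g y = g n \<oplus>\<^bsub>W\<^esub> g x" "g n \<in> N'" "g x \<in> carrier W"
      using g n x N by (auto simp: additive_map_def)
    then have "g y \<in> N' +>\<^bsub>W\<^esub> g x" by (auto simp: a_r_coset_def')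
    then show ?thesis
      using W.a_repr_independence[OF _ \<open>g x \<in> carrier W\<close> W.a_subgroup] by simp
  qed
  moreover have "x \<in> N +> x" using x by (rule a_rcos_self)
  ultimately show ?thesis unfolding coset_map_def by blast
qed

lemma quotient_smult:
  assumes "x \<in> carrier V"
  shows "c \<odot>\<^bsub>quotient V N\<^esub> (N +> x) = N +> (c \<odot> x)"
  using coset_map_eq[OF operator_subgroup_axioms, of "\<lambda>x. c \<odot> x" x] assms
  by (simp add: quotient_def additive_map_def smult_add smult_sub)

lemma quotient_operator_group: "operator_group (quotient V N)"
proof -
  have "abelian_group (quotient V N)"
  proof (rule abelian_groupI, goal_cases)
    case (6 X)
    then obtain x where x: "x \<in> carrier V" "X = N +> x" by (auto simp: quotient_carrier)
    then show ?case
      by (intro bexI[of _ "N +> (\<ominus> x)"]) (auto simp: quotient_add l_neg quotient_zero coset_eq_self_iff quotient_carrier)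
  next
    case 2 then show ?case
     using coset_eq_self_iff[of \<zero>] by (force simp: quotient_carrier quotient_zero)
  next
   case (5 X)
   then obtain x where x: "x \<in> carrier V" "X = N +> x" by (auto simp: quotient_carrier)
   have "\<zero>\<^bsub>quotient V N\<^esub> = N +> \<zero>"
     using coset_eq_self_iff[of \<zero>] by (simp add: quotient_zero)
   then show ?case using x by (simp add: quotient_add)
  qed (auto simp: quotient_carrier quotient_add a_ac)
  then show ?thesis
    by (intro operator_group.intro operator_group_axioms.intro)
      (auto simp: quotient_carrier quotient_add quotient_smult smult_add)
qed

end

text \<open>
The conditions concern representatives only, so that in the application to homology cosets of cosets
need not be analysed.
\<close>

lemma quotient_linear_iso:
  assumes V: "operator_subgroup N V" and W: "operator_subgroup N' W" and g: "operator_hom V W g"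
    and N: "\<And>x. x \<in> N \<Longrightarrow> g x \<in> N'"
    and inj: "\<And>x. x \<in> carrier V \<Longrightarrow> g x \<in> N' \<Longrightarrow> x \<in> N"
    and surj: "\<And>y. y \<in> carrier W \<Longrightarrow> \<exists>x\<in>carrier V. N' +>\<^bsub>W\<^esub> g x = N' +>\<^bsub>W\<^esub> y"
  shows "coset_map W N' g \<in> linear_iso (quotient V N) (quotient W N')"
proof -
  interpret V: operator_subgroup N V by fact
  interpret W: operator_subgroup N' W by fact
  have gc: "x \<in> carrier V \<Longrightarrow> g x \<in> carrier W" for x using g by (auto simp: operator_hom_def additive_map_def)
  have ga: "additive_map V W g" using g by (simp add: operator_hom_def)
  note eq = V.coset_map_eq[OF W ga N]
  interpret G: abelian_group_hom V W g
    by (rule abelian_group_homI)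
      (use ga in \<open>auto simp: additive_map_def V.abelian_group_axioms W.abelian_group_axioms group_hom_def
         group_hom_axioms_def hom_def V.a_group W.a_group\<close>)
  have gm: "g (x \<ominus>\<^bsub>V\<^esub> y) = g x \<ominus>\<^bsub>W\<^esub> g y" if xy: "x \<in> carrier V" "y \<in> carrier V" for x y
    using xy by (simp add: V.minus_eq W.minus_eq)
  have "coset_map W N' g \<in> hom (add_monoid (quotient V N)) (add_monoid (quotient W N'))"
    using g gc by (auto simp: hom_def V.quotient_carrier W.quotient_carrier eq V.quotient_add W.quotient_add operator_hom_def additive_map_def)
  moreover have "inj_on (coset_map W N' g) (carrier (quotient V N))"
  proof (rule inj_onI)
    fix X Y assume "X \<in> carrier (quotient V N)" "Y \<in> carrier (quotient V N)"
      and e: "coset_map W N' g X = coset_map W N' g Y"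
    then obtain x y where xy: "x \<in> carrier V" "y \<in> carrier V" "X = N +>\<^bsub>V\<^esub> x" "Y = N +>\<^bsub>V\<^esub> y"
      by (auto simp: V.quotient_carrier)
    then have "g (x \<ominus>\<^bsub>V\<^esub> y) \<in> N'"
      using e gc by (simp add: eq W.coset_eq_iff gm)
    then show "X = Y" using xy inj by (simp add: V.coset_eq_iff)
  qed
  moreover have "coset_map W N' g ` carrier (quotient V N) = carrier (quotient W N')"
  proof -
    have "coset_map W N' g ` carrier (quotient V N) = (\<lambda>x. N' +>\<^bsub>W\<^esub> g x) ` carrier V"
      unfolding V.quotient_carrier image_image by (rule image_cong) (simp_all add: eq)
    also have "\<dots> = carrier (quotient W N')"
      unfolding W.quotient_carrier
    proof (intro equalityI subsetI)
      fix Y assume "Y \<in> (\<lambda>y. N' +>\<^bsub>W\<^esub> y) ` carrier W"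
      then obtain y where "y \<in> carrier W" "Y = N' +>\<^bsub>W\<^esub> y" by blast
      then show "Y \<in> (\<lambda>x. N' +>\<^bsub>W\<^esub> g x) ` carrier V" using surj by blast
    next
      fix Y assume "Y \<in> (\<lambda>x. N' +>\<^bsub>W\<^esub> g x) ` carrier V"
      then show "Y \<in> (\<lambda>y. N' +>\<^bsub>W\<^esub> y) ` carrier W" using gc by blast
    qed
    finally show ?thesis .
  qed
  moreover have "\<forall>c. \<forall>X\<in>carrier (quotient V N).
      coset_map W N' g (c \<odot>\<^bsub>quotient V N\<^esub> X) = c \<odot>\<^bsub>quotient W N'\<^esub> coset_map W N' g X"
  proof (intro allI ballI)
    fix c X assume "X \<in> carrier (quotient V N)"
    then obtain x where x: "x \<in> carrier V" "X = N +>\<^bsub>V\<^esub> x" by (auto simp: V.quotient_carrier)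
    moreover have "g (c \<odot>\<^bsub>V\<^esub> x) = c \<odot>\<^bsub>W\<^esub> g x" using g x by (simp add: operator_hom_def)
    ultimately show "coset_map W N' g (c \<odot>\<^bsub>quotient V N\<^esub> X) = c \<odot>\<^bsub>quotient W N'\<^esub> coset_map W N' g X"
      by (simp add: eq V.quotient_smult W.quotient_smult gc)
  qed
  ultimately show ?thesis
    by (simp add: linear_iso_def iso_def bij_betw_def)
qed

lemma (in operator_subgroup) quotient_map_hom:
  assumes W: "operator_subgroup N' W" and g: "operator_hom V W g"
    and N: "\<And>x. x \<in> N \<Longrightarrow> g x \<in> N'"
  shows "operator_hom (quotient V N) (quotient W N') (coset_map W N' g)"
proof -
  interpret W: operator_subgroup N' W by fact
  have gc: "g x \<in> carrier W" if "x \<in> carrier V" for x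
    using g that by (auto simp: operator_hom_def additive_map_def)
  have ga: "g (x \<oplus> y) = g x \<oplus>\<^bsub>W\<^esub> g y" if "x \<in> carrier V" "y \<in> carrier V" for x y
    using g that by (auto simp: operator_hom_def additive_map_def)
  have gs: "g (c \<odot> x) = c \<odot>\<^bsub>W\<^esub> g x" if "x \<in> carrier V" for c x
    using g that by (auto simp: operator_hom_def)
  have "additive_map V W g" using g by (simp add: operator_hom_def)
  note eq = coset_map_eq[OF W this N]
  show ?thesis unfolding operator_hom_def additive_map_def
    by (auto simp: quotient_carrier W.quotient_carrier eq gc ga gs quotient_add W.quotient_add
        quotient_smult W.quotient_smult)
qed

lemma operator_subgroupI:
  assumes "operator_group V" "H \<subseteq> carrier V" "\<zero>\<^bsub>V\<^esub> \<in> H"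
    and "\<And>x y. x \<in> H \<Longrightarrow> y \<in> H \<Longrightarrow> x \<oplus>\<^bsub>V\<^esub> y \<in> H"
    and "\<And>x. x \<in> H \<Longrightarrow> \<ominus>\<^bsub>V\<^esub> x \<in> H"
    and "\<And>c x. x \<in> H \<Longrightarrow> c \<odot>\<^bsub>V\<^esub> x \<in> H"
  shows "operator_subgroup H V"
proof -
  interpret operator_group V by fact
  have "additive_subgroup H V"
    by (rule additive_subgroupI, rule subgroup.intro) (use assms in \<open>auto simp: a_inv_def\<close>)
  then show ?thesis
    by (intro operator_subgroup.intro operator_subgroup_axioms.intro) (use assms in auto)
qed

lemma operator_hom_group_hom:
  assumes "operator_group V" "operator_group W" "operator_hom V W g"
  shows "abelian_group_hom V W g"
proof -
  interpret V: operator_group V by fact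
  interpret W: operator_group W by fact
  show ?thesis
  by (rule abelian_group_homI)
    (use assms(3) in \<open>auto simp: operator_hom_def additive_map_def V.abelian_group_axioms
       W.abelian_group_axioms group_hom_def group_hom_axioms_def hom_def V.a_group W.a_group\<close>)
qed

lemma kernel_operator_subgroup:
  assumes V: "operator_group V" and W: "operator_group W" and g: "operator_hom V W g"
    and z: "\<And>c. c \<odot>\<^bsub>W\<^esub> \<zero>\<^bsub>W\<^esub> = \<zero>\<^bsub>W\<^esub>"
  shows "operator_subgroup {x \<in> carrier V. g x = \<zero>\<^bsub>W\<^esub>} V"
proof -
  interpret V: operator_group V by fact
  interpret W: operator_group W by fact
  interpret G: abelian_group_hom V W g using operator_hom_group_hom[OF V W g] .
  have "g (c \<odot>\<^bsub>V\<^esub> x) = c \<odot>\<^bsub>W\<^esub> g x" if "x \<in> carrier V" for c x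
    using g that by (auto simp: operator_hom_def)
  then show ?thesis by (intro operator_subgroupI V) (auto simp: z)
qed

lemma image_operator_subgroup:
  assumes V: "operator_group V" and W: "operator_group W" and g: "operator_hom V W g"
  shows "operator_subgroup (g ` carrier V) W"
proof -
  interpret V: operator_group V by fact
  interpret W: operator_group W by fact
  interpret G: abelian_group_hom V W g using operator_hom_group_hom[OF V W g] .
  have gs: "c \<odot>\<^bsub>W\<^esub> g x = g (c \<odot>\<^bsub>V\<^esub> x)" if "x \<in> carrier V" for c x
    using g that by (auto simp: operator_hom_def)
  have "\<zero>\<^bsub>W\<^esub> \<in> g ` carrier V"
    using V.zero_closed G.hom_zero by (metis image_eqI)
  moreover have "g x \<oplus>\<^bsub>W\<^esub> g y \<in> g ` carrier V" if "x \<in> carrier V" "y \<in> carrier V" for x y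
    using that G.hom_add V.a_closed by (metis image_eqI)
  moreover have "\<ominus>\<^bsub>W\<^esub> g x \<in> g ` carrier V" if "x \<in> carrier V" for x
    using that G.hom_a_inv V.a_inv_closed by (metis image_eqI)
  ultimately show ?thesis by (intro operator_subgroupI W) (auto simp: gs)
qed

lemma (in operator_subgroup) restrict_operator_group:
  "operator_group (V\<lparr>carrier := N\<rparr>)"
proof -
  have "abelian_group (V\<lparr>carrier := N\<rparr>)"
  proof (rule abelian_groupI, goal_cases)
    case (6 x)
    then show ?case using a_inv_closed[of x] a_subset by (auto intro!: bexI[of _ "\<ominus> x"] simp: l_neg)
  qed (use a_subset in \<open>auto simp: a_ac subset_iff\<close>)
  then show ?thesis
    by (intro operator_group.intro operator_group_axioms.intro)
      (use a_subset in \<open>auto simp: smult_sub smult_add subset_iff\<close>)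
qed

lemma (in operator_subgroup) restrict_operator_subgroup:
  assumes "operator_subgroup M V" "M \<subseteq> N"
  shows "operator_subgroup M (V\<lparr>carrier := N\<rparr>)"
proof -
  interpret M: operator_subgroup M V by fact
  interpret R: operator_group "V\<lparr>carrier := N\<rparr>" by (rule restrict_operator_group)
  have inv: "\<ominus>\<^bsub>V\<lparr>carrier := N\<rparr>\<^esub> x = \<ominus> x" if x: "x \<in> N" for x
  proof -
    have "\<ominus> x \<oplus> x = \<zero>" using x a_subset by (auto simp: l_neg)
    then show ?thesis
      using R.minus_equality[of "\<ominus> x" x] x a_inv_closed[of x] by simp
  qed
  show ?thesis
    by (rule operator_subgroupI[OF restrict_operator_group])
      (use assms(2) in \<open>auto simp: inv M.smult_sub subset_iff\<close>)
qed

section \<open>Free vector spaces and linearity modulo a subspace\<close>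

lemma carrier_free_space: "f \<in> carrier (free_space S) \<longleftrightarrow> Poly_Mapping.keys f \<subseteq> S"
  by (simp add: free_space_def)

lemma subspace_free_space: "pm.subspace (carrier (free_space S))"
proof (rule pm.subspaceI)
  show "0 \<in> carrier (free_space S)" by (simp add: free_space_def)
  show "x + y \<in> carrier (free_space S)" if "x \<in> carrier (free_space S)" "y \<in> carrier (free_space S)" for x y
    using that keys_add[of x y] by (auto simp: free_space_def)
  show "pm_scale c x \<in> carrier (free_space S)" if "x \<in> carrier (free_space S)" for c x
    using that by (auto simp: free_space_def in_keys_iff lookup_pm_scale)
qed

lemma free_space_sel [simp]: "x \<oplus>\<^bsub>free_space S\<^esub> y = x + y" "\<zero>\<^bsub>free_space S\<^esub> = 0" "c \<odot>\<^bsub>free_space S\<^esub> x = pm_scale c x"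
  by (simp_all add: free_space_def)

lemma free_space_operator_group: "operator_group (free_space S)"
proof -
  note sp = subspace_free_space[of S]
  have "abelian_group (free_space S)"
  proof (rule abelian_groupI, goal_cases)
    case (6 x)
    then show ?case using pm.subspace_neg[OF sp, of x] by (auto intro!: bexI[of _ "- x"])
  qed (use pm.subspace_add[OF sp] pm.subspace_0[OF sp] in \<open>auto simp: add_ac\<close>)
  then show ?thesis
    by (intro operator_group.intro operator_group_axioms.intro)
      (use pm.subspace_scale[OF sp] in \<open>auto simp: pm.scale_right_distrib\<close>)
qed

lemma free_space_a_inv [simp]:
  assumes "x \<in> carrier (free_space S)"
  shows "\<ominus>\<^bsub>free_space S\<^esub> x = - x"
proof -
  interpret operator_group "free_space S" by (rule free_space_operator_group)
  show ?thesis
    using minus_equality[of "-x" x] assms pm.subspace_neg[OF subspace_free_space, of x] by auto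
qed

lemma subspace_operator_subgroup:
  assumes "pm.subspace N" "N \<subseteq> carrier (free_space S)"
  shows "operator_subgroup N (free_space S)"
  using assms
  by (intro operator_subgroupI free_space_operator_group)
    (auto simp: pm.subspace_0 pm.subspace_add pm.subspace_neg pm.subspace_scale subset_iff)

lemma single_in_free_space [simp]: "Poly_Mapping.single x (1::'k::field) \<in> carrier (free_space S) \<longleftrightarrow> x \<in> S"
  by (simp add: carrier_free_space)

lemma pm_extend_mem:
  assumes "pm.subspace R" "f \<in> carrier (free_space S)" "\<And>x. x \<in> S \<Longrightarrow> g x \<in> R"
  shows "pm_extend g f \<in> R"
  unfolding pm_extend_def
  using assms by (intro pm.subspace_sum pm.subspace_scale) (auto simp: carrier_free_space)

lemma pm_extend_neg: "pm_extend g (- f) = - pm_extend g f"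
  using pm_extend_add[of g f "- f"] by (simp add: eq_neg_iff_add_eq_0 add.commute)

lemma pm_extend_diff: "pm_extend g (f - f') = pm_extend g f - pm_extend g f'"
  using pm_extend_add[of g f "- f'"] by (simp add: pm_extend_neg)

lemma pm_extend_fun_diff: "pm_extend (\<lambda>x. g x - h x) f = pm_extend g f - pm_extend h f"
  by (simp add: pm_extend_def pm.scale_right_diff_distrib sum_subtractf)

lemma subspace_preimage_extend:
  assumes "pm.subspace R"
  shows "pm.subspace {f. pm_extend g f \<in> R}"
  by (rule pm.subspaceI)
    (use assms in \<open>auto simp: pm_extend_add pm_extend_scale pm.subspace_0 pm.subspace_add pm.subspace_scale\<close>)

lemma pm_extend_operator_hom:
  assumes "\<And>x. x \<in> S \<Longrightarrow> g x \<in> carrier (free_space S')"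
  shows "operator_hom (free_space S) (free_space S') (pm_extend g)"
  using pm_extend_mem[OF subspace_free_space _ assms]
  by (auto simp: operator_hom_def additive_map_def pm_extend_add pm_extend_scale)

text \<open>
These are the linear maps into the quotient by \<open>R\<close>, given by representatives.
\<close>

definition linear_mod :: "('k::field, 'a) module \<Rightarrow> ('s \<Rightarrow>\<^sub>0 'k) set \<Rightarrow> ('a \<Rightarrow> 's \<Rightarrow>\<^sub>0 'k) \<Rightarrow> bool" where
  "linear_mod V R F \<longleftrightarrow>
     (\<forall>x\<in>carrier V. \<forall>y\<in>carrier V. F (x \<oplus>\<^bsub>V\<^esub> y) - F x - F y \<in> R) \<and>
     (\<forall>c. \<forall>x\<in>carrier V. F (c \<odot>\<^bsub>V\<^esub> x) - pm_scale c (F x) \<in> R)"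

lemma linear_mod_mono: "linear_mod V R F \<Longrightarrow> R \<subseteq> R' \<Longrightarrow> linear_mod V R' F"
  by (auto simp: linear_mod_def)

lemma linear_mod_add:
  assumes R: "pm.subspace R" and "linear_mod V R F" "linear_mod V R G"
  shows "linear_mod V R (\<lambda>x. F x + G x)"
  unfolding linear_mod_def
proof (intro conjI ballI allI)
  fix x y assume xy: "x \<in> carrier V" "y \<in> carrier V"
  have "F (x \<oplus>\<^bsub>V\<^esub> y) + G (x \<oplus>\<^bsub>V\<^esub> y) - (F x + G x) - (F y + G y)
     = (F (x \<oplus>\<^bsub>V\<^esub> y) - F x - F y) + (G (x \<oplus>\<^bsub>V\<^esub> y) - G x - G y)" by simp
  then show "F (x \<oplus>\<^bsub>V\<^esub> y) + G (x \<oplus>\<^bsub>V\<^esub> y) - (F x + G x) - (F y + G y) \<in> R"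
    using assms xy pm.subspace_add[OF R] by (simp only: linear_mod_def)
next
  fix c x assume x: "x \<in> carrier V"
  have "F (c \<odot>\<^bsub>V\<^esub> x) + G (c \<odot>\<^bsub>V\<^esub> x) - pm_scale c (F x + G x)
     = (F (c \<odot>\<^bsub>V\<^esub> x) - pm_scale c (F x)) + (G (c \<odot>\<^bsub>V\<^esub> x) - pm_scale c (G x))"
    by (simp add: pm.scale_right_distrib)
  then show "F (c \<odot>\<^bsub>V\<^esub> x) + G (c \<odot>\<^bsub>V\<^esub> x) - pm_scale c (F x + G x) \<in> R"
    using assms x pm.subspace_add[OF R] by (simp only: linear_mod_def)
qed

lemma linear_mod_diff:
  assumes R: "pm.subspace R" and "linear_mod V R F" "linear_mod V R G"
  shows "linear_mod V R (\<lambda>x. F x - G x)"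
  unfolding linear_mod_def
proof (intro conjI ballI allI)
  fix x y assume xy: "x \<in> carrier V" "y \<in> carrier V"
  have "F (x \<oplus>\<^bsub>V\<^esub> y) - G (x \<oplus>\<^bsub>V\<^esub> y) - (F x - G x) - (F y - G y)
     = (F (x \<oplus>\<^bsub>V\<^esub> y) - F x - F y) - (G (x \<oplus>\<^bsub>V\<^esub> y) - G x - G y)" by simp
  then show "F (x \<oplus>\<^bsub>V\<^esub> y) - G (x \<oplus>\<^bsub>V\<^esub> y) - (F x - G x) - (F y - G y) \<in> R"
    using assms xy pm.subspace_diff[OF R] by (simp only: linear_mod_def)
next
  fix c x assume x: "x \<in> carrier V"
  have "F (c \<odot>\<^bsub>V\<^esub> x) - G (c \<odot>\<^bsub>V\<^esub> x) - pm_scale c (F x - G x)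
     = (F (c \<odot>\<^bsub>V\<^esub> x) - pm_scale c (F x)) - (G (c \<odot>\<^bsub>V\<^esub> x) - pm_scale c (G x))"
    by (simp add: pm.scale_right_diff_distrib)
  then show "F (c \<odot>\<^bsub>V\<^esub> x) - G (c \<odot>\<^bsub>V\<^esub> x) - pm_scale c (F x - G x) \<in> R"
    using assms x pm.subspace_diff[OF R] by (simp only: linear_mod_def)
qed

lemma linear_mod_comp:
  assumes "operator_hom U V g" "linear_mod V R F"
  shows "linear_mod U R (\<lambda>x. F (g x))"
  using assms by (simp add: linear_mod_def operator_hom_def additive_map_def)

text \<open>
The preimage of \<open>R\<close> is closed under the operations, being the kernel of the induced map into the
quotient by \<open>R\<close>.
\<close>

lemma linear_mod_kernel:
  assumes R: "pm.subspace R" and F: "linear_mod V R F" and "x \<in> carrier V" 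
  shows "y \<in> carrier V \<Longrightarrow> F x \<in> R \<Longrightarrow> F y \<in> R \<Longrightarrow> F (x \<oplus>\<^bsub>V\<^esub> y) \<in> R"
    and "F x \<in> R \<Longrightarrow> F (c \<odot>\<^bsub>V\<^esub> x) \<in> R"
proof -
  assume y: "y \<in> carrier V" "F x \<in> R" "F y \<in> R"
  have "F (x \<oplus>\<^bsub>V\<^esub> y) = (F (x \<oplus>\<^bsub>V\<^esub> y) - F x - F y) + (F x + F y)" by simp
  then show "F (x \<oplus>\<^bsub>V\<^esub> y) \<in> R"
    using y F assms(3) pm.subspace_add[OF R] unfolding linear_mod_def by metis
next
  assume x: "F x \<in> R"
  have "F (c \<odot>\<^bsub>V\<^esub> x) = (F (c \<odot>\<^bsub>V\<^esub> x) - pm_scale c (F x)) + pm_scale c (F x)" by simp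
  then show "F (c \<odot>\<^bsub>V\<^esub> x) \<in> R"
    using x F assms(3) pm.subspace_add[OF R] pm.subspace_scale[OF R] unfolding linear_mod_def by metis
qed

lemma linear_mod_zero:
  assumes "operator_group V" "pm.subspace R" "linear_mod V R F"
  shows "F \<zero>\<^bsub>V\<^esub> \<in> R"
proof -
  interpret operator_group V by fact
  have "F (\<zero>\<^bsub>V\<^esub> \<oplus>\<^bsub>V\<^esub> \<zero>\<^bsub>V\<^esub>) - F \<zero>\<^bsub>V\<^esub> - F \<zero>\<^bsub>V\<^esub> \<in> R"
    using assms(3) zero_closed unfolding linear_mod_def by blast
  then have "- F \<zero>\<^bsub>V\<^esub> \<in> R" by simp
  then show ?thesis using pm.subspace_neg[OF assms(2)] by fastforce
qed

lemma linear_mod_exact: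
  assumes "pm.subspace R" "\<And>x y. x \<in> carrier V \<Longrightarrow> y \<in> carrier V \<Longrightarrow> F (x \<oplus>\<^bsub>V\<^esub> y) = F x + F y"
    "\<And>c x. x \<in> carrier V \<Longrightarrow> F (c \<odot>\<^bsub>V\<^esub> x) = pm_scale c (F x)"
  shows "linear_mod V R F"
  using assms by (simp add: linear_mod_def pm.subspace_0)

section \<open>Algebras, quotients and homomorphisms\<close>

locale k_algebra = ring A for A :: "('k::field, 'a) module" (structure) +
  assumes alg_smult_closed: "x \<in> carrier A \<Longrightarrow> c \<odot> x \<in> carrier A"
    and alg_smult_add: "x \<in> carrier A \<Longrightarrow> y \<in> carrier A \<Longrightarrow> c \<odot> (x \<oplus> y) = c \<odot> x \<oplus> c \<odot> y"
    and smult_mult_left: "x \<in> carrier A \<Longrightarrow> y \<in> carrier A \<Longrightarrow> (c \<odot> x) \<otimes> y = c \<odot> (x \<otimes> y)"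
    and smult_mult_right: "x \<in> carrier A \<Longrightarrow> y \<in> carrier A \<Longrightarrow> x \<otimes> (c \<odot> y) = c \<odot> (x \<otimes> y)"

sublocale k_algebra \<subseteq> operator_group A
  by (intro operator_group.intro operator_group_axioms.intro abelian_group_axioms alg_smult_closed alg_smult_add)

lemma (in k_algebra) op_group: "operator_group A"
  by (rule operator_group_axioms)

lemma (in k_algebra) mult_hom:
  "a \<in> carrier A \<Longrightarrow> operator_hom A A (\<lambda>x. a \<otimes> x)"
  "a \<in> carrier A \<Longrightarrow> operator_hom A A (\<lambda>x. x \<otimes> a)"
  by (simp_all add: operator_hom_def additive_map_def r_distr l_distr smult_mult_left smult_mult_right)

definition algebra_hom :: "('k::field, 'a) module \<Rightarrow> ('k, 'b) module \<Rightarrow> ('a \<Rightarrow> 'b) \<Rightarrow> bool" where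
  "algebra_hom A B \<phi> \<longleftrightarrow> operator_hom A B \<phi> \<and>
     (\<forall>x\<in>carrier A. \<forall>y\<in>carrier A. \<phi> (x \<otimes>\<^bsub>A\<^esub> y) = \<phi> x \<otimes>\<^bsub>B\<^esub> \<phi> y)"

lemma algebra_hom_closed: "algebra_hom A B \<phi> \<Longrightarrow> x \<in> carrier A \<Longrightarrow> \<phi> x \<in> carrier B"
  by (simp add: algebra_hom_def operator_hom_def additive_map_def)

lemma comp_algebra_hom: "algebra_hom A B f \<Longrightarrow> algebra_hom B C g \<Longrightarrow> algebra_hom A C (\<lambda>x. g (f x))"
  by (simp add: algebra_hom_def operator_hom_def additive_map_def)

lemma (in k_algebra) ideal_operator_subgroup:
  assumes "ideal J A"
  shows "operator_subgroup J A"
proof -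
  interpret J: ideal J A by fact
  have "c \<odot> x \<in> J" if "x \<in> J" for c x
  proof -
    have "x \<in> carrier A" using that J.a_subset by auto
    then have "c \<odot> x = (c \<odot> \<one>) \<otimes> x" by (simp add: smult_mult_left)
    then show ?thesis using that by (simp add: J.I_l_closed)
  qed
  then show ?thesis
    by (intro operator_subgroup.intro operator_subgroup_axioms.intro op_group J.additive_subgroup_axioms)
qed

lemma (in k_algebra) quotient_mult:
  assumes "ideal J A" "x \<in> carrier A" "y \<in> carrier A"
  shows "(J +> x) \<otimes>\<^bsub>quotient A J\<^esub> (J +> y) = J +> x \<otimes> y"
  using ideal.rcoset_mult_add[OF assms] by (simp add: quotient_def FactRing_def)

lemma (in k_algebra) quotient_k_algebra:
  assumes J: "ideal J A"
  shows "k_algebra (quotient A J)"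
proof -
  interpret S: operator_subgroup J A using J by (rule ideal_operator_subgroup)
  interpret R: operator_group "quotient A J" by (rule S.quotient_operator_group)
  interpret QR: ring "A Quot J" using J by (rule ideal.quotient_is_ring)
  have "monoid (quotient A J)"
    using QR.monoid_axioms unfolding Group.monoid_def quotient_def by simp
  then have "ring (quotient A J)"
    by (intro ringI R.abelian_group_axioms)
      (auto simp: S.quotient_carrier S.quotient_add quotient_mult[OF J] l_distr r_distr)
  then show ?thesis
    by (intro k_algebra.intro k_algebra_axioms.intro)
      (auto simp: S.quotient_carrier S.quotient_add quotient_mult[OF J] S.quotient_smult smult_add
         smult_mult_left smult_mult_right)
qed

lemma (in k_algebra) quotient_proj_hom:
  assumes J: "ideal J A"
  shows "algebra_hom A (quotient A J) (\<lambda>x. J +> x)"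
proof -
  interpret S: operator_subgroup J A using J by (rule ideal_operator_subgroup)
  show ?thesis
    by (auto simp: algebra_hom_def operator_hom_def additive_map_def S.quotient_carrier S.quotient_add
        quotient_mult[OF J] S.quotient_smult)
qed

lemma coset_map_algebra_hom:
  assumes A: "k_algebra A" and B: "k_algebra B" and J: "ideal J A" and J': "ideal J' B"
    and g: "algebra_hom A B g" and sub: "\<And>x. x \<in> J \<Longrightarrow> g x \<in> J'"
  shows "algebra_hom (quotient A J) (quotient B J') (coset_map B J' g)"
    and "x \<in> carrier A \<Longrightarrow> coset_map B J' g (J +>\<^bsub>A\<^esub> x) = J' +>\<^bsub>B\<^esub> g x"
proof -
  interpret A: k_algebra A by fact
  interpret B: k_algebra B by fact
  interpret S: operator_subgroup J A using J by (rule A.ideal_operator_subgroup)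
  interpret S': operator_subgroup J' B using J' by (rule B.ideal_operator_subgroup)
  have g': "operator_hom A B g" using g by (simp add: algebra_hom_def)
  then have g'': "additive_map A B g" by (simp add: operator_hom_def)
  note eq = S.coset_map_eq[OF S'.operator_subgroup_axioms g'' sub]
  have gm: "g (x \<otimes>\<^bsub>A\<^esub> y) = g x \<otimes>\<^bsub>B\<^esub> g y" if "x \<in> carrier A" "y \<in> carrier A" for x y
    using g that by (simp add: algebra_hom_def)
  show "algebra_hom (quotient A J) (quotient B J') (coset_map B J' g)"
    unfolding algebra_hom_def
    using S.quotient_map_hom[OF S'.operator_subgroup_axioms g' sub]
    by (auto simp: S.quotient_carrier A.quotient_mult[OF J] B.quotient_mult[OF J'] eq gm algebra_hom_closed[OF g])
  show "x \<in> carrier A \<Longrightarrow> coset_map B J' g (J +>\<^bsub>A\<^esub> x) = J' +>\<^bsub>B\<^esub> g x"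
    by (rule eq)
qed

lemma preimage_ideal:
  assumes A: "k_algebra A" and B: "k_algebra B" and g: "algebra_hom A B g" and I: "ideal I B"
  shows "ideal {x \<in> carrier A. g x \<in> I} A"
proof -
  interpret A: k_algebra A by fact
  interpret B: k_algebra B by fact
  interpret I: ideal I B by fact
  have g': "operator_hom A B g" using g by (simp add: algebra_hom_def)
  interpret G: abelian_group_hom A B g using operator_hom_group_hom[OF A.op_group B.op_group g'] .
  have gm: "g (x \<otimes>\<^bsub>A\<^esub> y) = g x \<otimes>\<^bsub>B\<^esub> g y" if "x \<in> carrier A" "y \<in> carrier A" for x y
    using g that by (simp add: algebra_hom_def)
  show ?thesis
  proof (rule idealI[OF A.ring_axioms])
    show "subgroup {x \<in> carrier A. g x \<in> I} (add_monoid A)"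
      by (rule subgroup.intro) (auto simp flip: a_inv_def)
  qed (auto simp: gm I.I_l_closed I.I_r_closed)
qed

section \<open>Tensor powers\<close>

abbreviation pure :: "'a list \<Rightarrow> ('a list \<Rightarrow>\<^sub>0 'k::field)" where
  "pure xs \<equiv> Poly_Mapping.single xs 1"

lemma tensor_rel_subspace: "pm.subspace (tensor_rel A n)"
  unfolding tensor_rel_def by (rule pm.subspace_span)

text \<open>
The varying factor stands between two lists, which makes every position of the tensor accessible to
unification.
\<close>

lemma pure_linear:
  assumes "xs @ ys \<in> tensor_lists A m" "n = Suc m" "operator_group A"
  shows "linear_mod A (tensor_rel A n) (\<lambda>x. pure (xs @ x # ys))"
proof -
  interpret operator_group A by fact
  have *: "xs @ z # ys \<in> tensor_lists A n" "length xs < n" if "z \<in> carrier A" for z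
    using assms(1,2) that by (auto simp: tensor_lists_def)
  have u: "(xs @ z # ys)[length xs := x] = xs @ x # ys" for x z by simp
  show ?thesis unfolding linear_mod_def
  proof (intro conjI ballI allI)
    fix x y assume xy: "x \<in> carrier A" "y \<in> carrier A"
    show "pure (xs @ (x \<oplus>\<^bsub>A\<^esub> y) # ys) - pure (xs @ x # ys) - pure (xs @ y # ys) \<in> tensor_rel A n"
      unfolding tensor_rel_def
      by (rule pm.span_base, rule UnI1, rule CollectI,
          rule exI[of _ "xs @ x # ys"], rule exI[of _ "length xs"], rule exI[of _ x], rule exI[of _ y])
        (use * xy in simp)
  next
    fix c x assume x: "x \<in> carrier A"
    show "pure (xs @ (c \<odot>\<^bsub>A\<^esub> x) # ys) - pm_scale c (pure (xs @ x # ys)) \<in> tensor_rel A n"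
      unfolding tensor_rel_def
      by (rule pm.span_base, rule UnI2, rule CollectI,
          rule exI[of _ "xs @ x # ys"], rule exI[of _ "length xs"], rule exI[of _ c], rule exI[of _ x])
        (use * x in simp)
  qed
qed

text \<open>
The universal property of the tensor power: a function of lists that is linear modulo \<open>R\<close> in each entry
factors through it.
\<close>

lemma tensor_rel_universal:
  assumes R: "pm.subspace R"
    and g: "\<And>xs ys. set xs \<subseteq> carrier A \<Longrightarrow> set ys \<subseteq> carrier A \<Longrightarrow> Suc (length xs + length ys) = n \<Longrightarrow>
        linear_mod A R (\<lambda>x. g (xs @ x # ys))"
    and f: "f \<in> tensor_rel A n"
  shows "pm_extend g f \<in> R"
proof -
  have g': "linear_mod A R (\<lambda>x. g (xs[i := x]))" if "xs \<in> tensor_lists A n" "i < n" for xs i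
    using g[of "take i xs" "drop (Suc i) xs"] that
    by (auto simp: tensor_lists_def upd_conv_take_nth_drop dest!: in_set_takeD in_set_dropD)
  have "tensor_rel A n \<subseteq> {f. pm_extend g f \<in> R}"
    unfolding tensor_rel_def
    by (rule pm.span_minimal[OF _ subspace_preimage_extend[OF R]])
      (use g' in \<open>auto simp: pm_extend_diff pm_extend_scale linear_mod_def\<close>)
  then show ?thesis using f by blast
qed

lemma tensor_rel_free:
  assumes "operator_group A"
  shows "tensor_rel A n \<subseteq> carrier (free_space (tensor_lists A n))"
proof -
  interpret operator_group A by fact
  have *: "xs[i := x] \<in> tensor_lists A n" if "xs \<in> tensor_lists A n" "x \<in> carrier A" for xs i x
    using that set_update_subset_insert[of xs i x] by (auto simp: tensor_lists_def)
  show ?thesis unfolding tensor_rel_def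
    by (rule pm.span_minimal[OF _ subspace_free_space])
      (auto intro!: pm.subspace_diff[OF subspace_free_space] pm.subspace_scale[OF subspace_free_space] *)
qed

lemma tensor_rel_operator_subgroup:
  "operator_group A \<Longrightarrow> operator_subgroup (tensor_rel A n) (free_space (tensor_lists A n))"
  by (intro subspace_operator_subgroup tensor_rel_subspace tensor_rel_free)

section \<open>Hochschild homology in degree one\<close>

lemma tensor_lists_cases:
  "xs \<in> tensor_lists A 1 \<longleftrightarrow> (\<exists>a\<in>carrier A. xs = [a])"
  "xs \<in> tensor_lists A 2 \<longleftrightarrow> (\<exists>a\<in>carrier A. \<exists>b\<in>carrier A. xs = [a, b])"
  "xs \<in> tensor_lists A 3 \<longleftrightarrow> (\<exists>a\<in>carrier A. \<exists>b\<in>carrier A. \<exists>c\<in>carrier A. xs = [a, b, c])"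
  by (auto simp: tensor_lists_def eval_nat_numeral length_Suc_conv One_nat_def)

\<comment> \<open>Otherwise the simplifier rewrites the degree \<open>1\<close> to \<open>Suc 0\<close>.\<close>
declare One_nat_def [simp del]

lemma hoch_boundary_1: "hoch_boundary A 1 [a, b] = pure [a \<otimes>\<^bsub>A\<^esub> b] - pure [b \<otimes>\<^bsub>A\<^esub> a]"
  by (simp add: hoch_boundary_def hoch_face_def One_nat_def)

lemma hoch_boundary_2:
  "hoch_boundary A 2 [a, b, c] =
     pure [a \<otimes>\<^bsub>A\<^esub> b, c] - pure [a, b \<otimes>\<^bsub>A\<^esub> c] + pure [c \<otimes>\<^bsub>A\<^esub> a, b]"
  by (simp add: hoch_boundary_def hoch_face_def eval_nat_numeral One_nat_def)

context k_algebra
begin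

abbreviation "tens n \<equiv> free_space (tensor_lists A n) :: ('k, 'a list \<Rightarrow>\<^sub>0 'k) module"
abbreviation "rel n \<equiv> tensor_rel A n"
abbreviation "d n \<equiv> pm_extend (hoch_boundary A n)"

lemma pure_linear_1: "linear_mod A (rel 1) (\<lambda>x. pure [x])"
  using pure_linear[of "[]" "[]" A 0 1] op_group by (simp add: tensor_lists_def One_nat_def)

lemma pure_linear_2:
  "a \<in> carrier A \<Longrightarrow> linear_mod A (rel 2) (\<lambda>x. pure [a, x])"
  "a \<in> carrier A \<Longrightarrow> linear_mod A (rel 2) (\<lambda>x. pure [x, a])"
  using pure_linear[of "[a]" "[]" A 1 2] pure_linear[of "[]" "[a]" A 1 2] op_group
  by (simp_all add: tensor_lists_cases)

lemmas tensor_rel_subspace [simp]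

lemma d1_rel: "f \<in> rel 2 \<Longrightarrow> d 1 f \<in> rel 1"
proof (rule tensor_rel_universal[where n = 2 and A = A])
  fix xs ys assume *: "set xs \<subseteq> carrier A" "set ys \<subseteq> carrier A" "Suc (length xs + length ys) = 2"
  consider a where "xs = []" "ys = [a]" "a \<in> carrier A" | a where "xs = [a]" "ys = []" "a \<in> carrier A"
    using * by (cases xs; cases ys) auto
  then show "linear_mod A (rel 1) (\<lambda>x. hoch_boundary A 1 (xs @ x # ys))"
    by cases (auto simp: hoch_boundary_1 intro!: linear_mod_diff linear_mod_comp[OF _ pure_linear_1] mult_hom)
qed auto

lemma d2_rel: "f \<in> rel 3 \<Longrightarrow> d 2 f \<in> rel 2"
proof (rule tensor_rel_universal[where n = 3 and A = A])
  fix xs ys assume *: "set xs \<subseteq> carrier A" "set ys \<subseteq> carrier A" "Suc (length xs + length ys) = 3"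
  consider a b where "xs = []" "ys = [a, b]" "a \<in> carrier A" "b \<in> carrier A"
    | a b where "xs = [a]" "ys = [b]" "a \<in> carrier A" "b \<in> carrier A"
    | a b where "xs = [a, b]" "ys = []" "a \<in> carrier A" "b \<in> carrier A"
    using * by (cases xs; cases ys; cases "tl xs"; cases "tl ys") auto
  then show "linear_mod A (rel 2) (\<lambda>x. hoch_boundary A 2 (xs @ x # ys))"
    by cases (auto simp: hoch_boundary_2 intro!: linear_mod_diff linear_mod_add pure_linear_2
        linear_mod_comp[OF _ pure_linear_2(1)] linear_mod_comp[OF _ pure_linear_2(2)] mult_hom)
qed auto

lemma d1_free: "f \<in> carrier (tens 2) \<Longrightarrow> d 1 f \<in> carrier (tens 1)"
  by (rule pm_extend_mem[OF subspace_free_space])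
    (auto simp: tensor_lists_cases hoch_boundary_1 intro!: pm.subspace_diff[OF subspace_free_space])

lemma d2_free: "f \<in> carrier (tens 3) \<Longrightarrow> d 2 f \<in> carrier (tens 2)"
  by (rule pm_extend_mem[OF subspace_free_space])
    (auto simp: tensor_lists_cases hoch_boundary_2
      intro!: pm.subspace_diff[OF subspace_free_space] pm.subspace_add[OF subspace_free_space])

text \<open>
By associativity the six terms cancel in pairs already as formal combinations of lists.
\<close>

lemma d1_d2: "f \<in> carrier (tens 3) \<Longrightarrow> d 1 (d 2 f) = 0"
proof -
  assume f: "f \<in> carrier (tens 3)"
  have "d 1 (d 2 f) = pm_extend (\<lambda>xs. d 1 (hoch_boundary A 2 xs)) f"
    by (simp add: pm_extend_extend)
  also have "\<dots> = pm_extend (\<lambda>_. 0) f"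
    by (rule pm_extend_cong)
      (use f in \<open>auto simp: carrier_free_space subset_iff tensor_lists_cases hoch_boundary_2 hoch_boundary_1
        pm_extend_diff pm_extend_add m_assoc\<close>)
  also have "\<dots> = 0" by (simp add: pm_extend_def)
  finally show ?thesis .
qed

lemma rel_subgroup: "operator_subgroup (rel n) (tens n)"
  by (rule tensor_rel_operator_subgroup[OF op_group])

lemma boundary_hom: "operator_hom (tens 2) (tens 1) (d 1)" "operator_hom (tens 3) (tens 2) (d 2)"
  using d1_free d2_free by (simp_all add: operator_hom_def additive_map_def pm_extend_add pm_extend_scale)

lemma hoch_chains_eq: "hoch_chains A 1 = quotient (tens 2) (rel 2)" "hoch_chains A 2 = quotient (tens 3) (rel 3)"
  by (simp_all add: hoch_chains_def tensor_power_def numeral_2_eq_2 numeral_3_eq_3 One_nat_def)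

lemma hoch_d1:
  "f \<in> carrier (tens 2) \<Longrightarrow> hoch_d A 1 (rel 2 +>\<^bsub>tens 2\<^esub> f) = rel 1 +>\<^bsub>tens 1\<^esub> d 1 f"
  unfolding hoch_d_def
  by (rule operator_subgroup.coset_map_eq[OF rel_subgroup rel_subgroup])
    (use boundary_hom d1_rel in \<open>auto simp: operator_hom_def\<close>)

lemma hoch_d2:
  "f \<in> carrier (tens 3) \<Longrightarrow> hoch_d A 2 (rel 3 +>\<^bsub>tens 3\<^esub> f) = rel 2 +>\<^bsub>tens 2\<^esub> d 2 f"
  unfolding hoch_d_def
  by (rule operator_subgroup.coset_map_eq[OF rel_subgroup rel_subgroup])
    (use boundary_hom d2_rel in \<open>auto simp: operator_hom_def\<close>)

definition cycles1 :: "('a list \<Rightarrow>\<^sub>0 'k) set" where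
  "cycles1 = {f \<in> carrier (tens 2). d 1 f \<in> rel 1}"

text \<open>
With \<open>cycles1\<close>, the representatives of cycles and of boundaries.  The summand \<open>t\<close> makes \<open>bounds1\<close>
independent of the choice of representatives.
\<close>

definition bounds1 :: "('a list \<Rightarrow>\<^sub>0 'k) set" where
  "bounds1 = {d 2 g + t | g t. g \<in> carrier (tens 3) \<and> t \<in> rel 2}"

lemma rel_in_free: "f \<in> rel n \<Longrightarrow> f \<in> carrier (tens n)"
  using tensor_rel_free[OF op_group] by blast

lemma bounds1_subspace [simp]: "pm.subspace bounds1"
proof -
  have "pm.subspace (d 2 ` carrier (tens 3))"
  proof (rule pm.subspaceI)
    show "0 \<in> d 2 ` carrier (tens 3)"
      by (rule image_eqI[of _ _ 0]) (simp_all add: pm.subspace_0[OF subspace_free_space])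
  qed (auto simp flip: pm_extend_add pm_extend_scale
       intro!: imageI pm.subspace_add[OF subspace_free_space] pm.subspace_scale[OF subspace_free_space])
  from pm.subspace_sums[OF this tensor_rel_subspace[of A 2]]
  have "pm.subspace {x + y |x y. x \<in> d 2 ` carrier (tens 3) \<and> y \<in> rel 2}" .
  also have "{x + y |x y. x \<in> d 2 ` carrier (tens 3) \<and> y \<in> rel 2} = bounds1"
    unfolding bounds1_def by blast
  finally show ?thesis .
qed

lemma rel_bounds1: "rel 2 \<subseteq> bounds1"
proof
  fix t assume "t \<in> rel 2"
  then have "t = d 2 0 + t \<and> 0 \<in> carrier (tens 3) \<and> t \<in> rel 2"
    by (simp add: pm.subspace_0[OF subspace_free_space])
  then show "t \<in> bounds1" unfolding bounds1_def by blast
qed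

lemma d2_bounds1:
  assumes "a \<in> carrier A" "b \<in> carrier A" "c \<in> carrier A"
  shows "pure [a \<otimes> b, c] - pure [a, b \<otimes> c] + pure [c \<otimes> a, b] \<in> bounds1"
proof -
  have "pure [a \<otimes> b, c] - pure [a, b \<otimes> c] + pure [c \<otimes> a, b] = d 2 (pure [a, b, c]) + 0"
    by (simp add: hoch_boundary_2)
  moreover have "pure [a, b, c] \<in> carrier (tens 3)" using assms by (simp add: tensor_lists_cases)
  ultimately show ?thesis unfolding bounds1_def using pm.subspace_0[OF tensor_rel_subspace] by blast
qed

lemma bounds1_cycles1: "bounds1 \<subseteq> cycles1"
  unfolding bounds1_def cycles1_def
  by (auto simp: pm_extend_add d1_d2 d2_free d1_rel rel_in_free
      intro!: pm.subspace_add[OF subspace_free_space])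

abbreviation cls :: "('a list \<Rightarrow>\<^sub>0 'k) \<Rightarrow> ('a list \<Rightarrow>\<^sub>0 'k) set" where
  "cls f \<equiv> rel 2 +>\<^bsub>tens 2\<^esub> f"

lemma cls_eq_iff: "f \<in> carrier (tens 2) \<Longrightarrow> g \<in> carrier (tens 2) \<Longrightarrow> cls f = cls g \<longleftrightarrow> f - g \<in> rel 2"
proof -
  interpret operator_subgroup "rel 2" "tens 2" by (rule rel_subgroup)
  show "f \<in> carrier (tens 2) \<Longrightarrow> g \<in> carrier (tens 2) \<Longrightarrow> cls f = cls g \<longleftrightarrow> f - g \<in> rel 2"
    by (simp add: coset_eq_iff minus_eq)
qed

lemma hoch_cycles_carrier: "carrier (hoch_cycles A 1) = cls ` cycles1"
proof -
  interpret T1: operator_subgroup "rel 1" "tens 1" by (rule rel_subgroup)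
  interpret T2: operator_subgroup "rel 2" "tens 2" by (rule rel_subgroup)
  have "hoch_d A 1 (cls f) = \<zero>\<^bsub>tensor_power A 1\<^esub> \<longleftrightarrow> d 1 f \<in> rel 1" if "f \<in> carrier (tens 2)" for f
    unfolding tensor_power_def T1.quotient_zero hoch_d1[OF that]
    by (rule T1.coset_eq_self_iff[OF d1_free[OF that]])
  moreover have "carrier (hoch_chains A 1) = cls ` carrier (tens 2)"
    by (simp add: hoch_chains_eq T2.quotient_carrier)
  ultimately show ?thesis
    unfolding hoch_cycles_def cycles1_def by auto
qed

lemma hoch_boundaries_eq: "hoch_boundaries A 1 = cls ` bounds1"
proof -
  interpret T3: operator_subgroup "rel 3" "tens 3" by (rule rel_subgroup)
  have "hoch_boundaries A 1 = hoch_d A 2 ` carrier (hoch_chains A 2)"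
    by (simp add: hoch_boundaries_def numeral_2_eq_2 One_nat_def)
  also have "\<dots> = (\<lambda>g. cls (d 2 g)) ` carrier (tens 3)"
    unfolding hoch_chains_eq T3.quotient_carrier image_image
    by (rule image_cong) (simp_all add: hoch_d2)
  also have "\<dots> = cls ` bounds1"
  proof (intro equalityI subsetI)
    fix X assume "X \<in> (\<lambda>g. cls (d 2 g)) ` carrier (tens 3)"
    then obtain g where "g \<in> carrier (tens 3)" "X = cls (d 2 g + 0)" by auto
    then show "X \<in> cls ` bounds1"
      unfolding bounds1_def using pm.subspace_0[OF tensor_rel_subspace] by blast
  next
    fix X assume "X \<in> cls ` bounds1"
    then obtain g t where g: "g \<in> carrier (tens 3)" "t \<in> rel 2" "X = cls (d 2 g + t)"
      unfolding bounds1_def by blast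
    then have "cls (d 2 g + t) = cls (d 2 g)"
      by (subst cls_eq_iff) (auto simp: d2_free rel_in_free intro!: pm.subspace_add[OF subspace_free_space])
    then show "X \<in> (\<lambda>g. cls (d 2 g)) ` carrier (tens 3)" using g by blast
  qed
  finally show ?thesis .
qed

lemma cls_mem_boundaries:
  assumes "f \<in> carrier (tens 2)"
  shows "cls f \<in> hoch_boundaries A 1 \<longleftrightarrow> f \<in> bounds1"
proof
  assume "cls f \<in> hoch_boundaries A 1"
  then obtain g where g: "g \<in> bounds1" "cls f = cls g" unfolding hoch_boundaries_eq by blast
  then have "f - g \<in> bounds1"
    using assms bounds1_cycles1 rel_bounds1 cls_eq_iff[of f g] by (auto simp: cycles1_def)
  from pm.subspace_add[OF bounds1_subspace this g(1)] show "f \<in> bounds1" by simp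
qed (auto simp: hoch_boundaries_eq)

lemma chains_group: "operator_group (hoch_chains A 1)" "operator_group (hoch_chains A 2)"
  unfolding hoch_chains_eq by (intro operator_subgroup.quotient_operator_group rel_subgroup)+

lemma cycles_subgroup: "operator_subgroup (cls ` cycles1) (hoch_chains A 1)"
proof -
  interpret T1: operator_subgroup "rel 1" "tens 1" by (rule rel_subgroup)
  have "operator_subgroup {X \<in> carrier (hoch_chains A 1). hoch_d A 1 X = \<zero>\<^bsub>tensor_power A 1\<^esub>} (hoch_chains A 1)"
  proof (rule kernel_operator_subgroup[OF chains_group(1)])
    show "operator_group (tensor_power A 1)" unfolding tensor_power_def by (rule T1.quotient_operator_group)
    show "operator_hom (hoch_chains A 1) (tensor_power A 1) (hoch_d A 1)"
      unfolding tensor_power_def hoch_chains_eq hoch_d_def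
      by (rule operator_subgroup.quotient_map_hom[OF rel_subgroup rel_subgroup boundary_hom(1) d1_rel])
    show "c \<odot>\<^bsub>tensor_power A 1\<^esub> \<zero>\<^bsub>tensor_power A 1\<^esub> = \<zero>\<^bsub>tensor_power A 1\<^esub>" for c
    proof -
      have "0 \<in> carrier (tens 1)" "0 \<in> rel 1"
        by (simp_all add: pm.subspace_0 subspace_free_space)
      then show ?thesis
        using T1.quotient_smult[of 0 c] T1.coset_eq_self_iff[of 0]
        by (simp add: tensor_power_def T1.quotient_zero)
    qed
  qed
  then show ?thesis using hoch_cycles_carrier by (simp add: hoch_cycles_def)
qed

lemma boundaries_subgroup: "operator_subgroup (hoch_boundaries A 1) (hoch_cycles A 1)"
proof -
  interpret Z: operator_subgroup "cls ` cycles1" "hoch_chains A 1" by (rule cycles_subgroup)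
  have "operator_subgroup (hoch_d A 2 ` carrier (hoch_chains A 2)) (hoch_chains A 1)"
  proof (rule image_operator_subgroup[OF chains_group(2) chains_group(1)])
    show "operator_hom (hoch_chains A 2) (hoch_chains A 1) (hoch_d A 2)"
      unfolding tensor_power_def hoch_chains_eq hoch_d_def
      by (rule operator_subgroup.quotient_map_hom[OF rel_subgroup rel_subgroup boundary_hom(2) d2_rel])
  qed
  moreover have "hoch_boundaries A 1 = hoch_d A 2 ` carrier (hoch_chains A 2)"
    by (simp add: hoch_boundaries_def numeral_2_eq_2 One_nat_def)
  ultimately have "operator_subgroup (hoch_boundaries A 1) (hoch_chains A 1)" by simp
  moreover have "hoch_boundaries A 1 \<subseteq> cls ` cycles1"
    unfolding hoch_boundaries_eq using bounds1_cycles1 by blast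
  moreover have "hoch_cycles A 1 = (hoch_chains A 1)\<lparr>carrier := cls ` cycles1\<rparr>"
    using hoch_cycles_carrier by (simp add: hoch_cycles_def)
  ultimately show ?thesis using Z.restrict_operator_subgroup by simp
qed

end

text \<open>
An algebra map acts on chains entry by entry and commutes with the faces, since these only multiply
entries.
\<close>

locale hoch_functoriality = A: k_algebra A + B: k_algebra B
  for A :: "('k::field, 'a) module" and B :: "('k, 'b) module" and \<phi> :: "'a \<Rightarrow> 'b" +
  assumes hom: "algebra_hom A B \<phi>"
begin

abbreviation "chain_map \<equiv> pm_extend (\<lambda>xs. pure (map \<phi> xs)) :: ('a list \<Rightarrow>\<^sub>0 'k) \<Rightarrow> ('b list \<Rightarrow>\<^sub>0 'k)"

lemma closed [simp]: "x \<in> carrier A \<Longrightarrow> \<phi> x \<in> carrier B"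
  using hom by (rule algebra_hom_closed)

lemma mult [simp]: "x \<in> carrier A \<Longrightarrow> y \<in> carrier A \<Longrightarrow> \<phi> (x \<otimes>\<^bsub>A\<^esub> y) = \<phi> x \<otimes>\<^bsub>B\<^esub> \<phi> y"
  using hom by (simp add: algebra_hom_def)

lemma map_tensor_lists: "xs \<in> tensor_lists A n \<Longrightarrow> map \<phi> xs \<in> tensor_lists B n"
  using closed by (auto simp: tensor_lists_def)

lemma map_free: "f \<in> carrier (A.tens n) \<Longrightarrow> chain_map f \<in> carrier (B.tens n)"
  by (rule pm_extend_mem[OF subspace_free_space]) (auto simp: map_tensor_lists)

lemma map_rel: "f \<in> A.rel n \<Longrightarrow> chain_map f \<in> B.rel n"
proof (rule tensor_rel_universal[where n = n and A = A])
  fix xs ys assume xy: "set xs \<subseteq> carrier A" "set ys \<subseteq> carrier A" "Suc (length xs + length ys) = n"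
  have "linear_mod B (B.rel n) (\<lambda>x. pure (map \<phi> xs @ x # map \<phi> ys))"
    by (rule pure_linear[OF _ xy(3)[symmetric] B.op_group])
      (use xy in \<open>auto simp: tensor_lists_def intro!: closed\<close>)
  moreover have "operator_hom A B \<phi>" using hom by (simp add: algebra_hom_def)
  ultimately have "linear_mod A (B.rel n) (\<lambda>x. pure (map \<phi> xs @ \<phi> x # map \<phi> ys))"
    using linear_mod_comp by blast
  then show "linear_mod A (B.rel n) (\<lambda>x. pure (map \<phi> (xs @ x # ys)))" by simp
qed auto

lemma map_d1: "f \<in> carrier (A.tens 2) \<Longrightarrow> chain_map (A.d 1 f) = B.d 1 (chain_map f)"
  unfolding pm_extend_extend
  by (rule pm_extend_cong)
    (auto simp: carrier_free_space subset_iff tensor_lists_cases hoch_boundary_1 pm_extend_diff)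

lemma map_d2: "f \<in> carrier (A.tens 3) \<Longrightarrow> chain_map (A.d 2 f) = B.d 2 (chain_map f)"
  unfolding pm_extend_extend
  by (rule pm_extend_cong)
    (auto simp: carrier_free_space subset_iff tensor_lists_cases hoch_boundary_2 pm_extend_diff pm_extend_add)

lemma map_cycles: "f \<in> A.cycles1 \<Longrightarrow> chain_map f \<in> B.cycles1"
  by (auto simp: A.cycles1_def B.cycles1_def map_free simp flip: map_d1 intro!: map_rel)

lemma map_bounds: "f \<in> A.bounds1 \<Longrightarrow> chain_map f \<in> B.bounds1"
  unfolding A.bounds1_def B.bounds1_def
  by (auto simp: pm_extend_add map_d2) (metis map_free map_rel)

lemma chain_map_cls:
  "f \<in> carrier (A.tens 2) \<Longrightarrow> hoch_chain_map 1 B \<phi> (A.cls f) = B.cls (chain_map f)"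
  unfolding hoch_chain_map_def Suc_1
  by (rule operator_subgroup.coset_map_eq[OF A.rel_subgroup B.rel_subgroup])
    (auto simp: additive_map_def pm_extend_add map_free intro!: map_rel)

lemma chain_map_boundaries:
  "X \<in> hoch_boundaries A 1 \<Longrightarrow> hoch_chain_map 1 B \<phi> X \<in> hoch_boundaries B 1"
  unfolding A.hoch_boundaries_eq B.hoch_boundaries_eq
  using A.bounds1_cycles1 map_bounds by (auto simp: chain_map_cls A.cycles1_def)

lemma chain_map_hom: "operator_hom (hoch_cycles A 1) (hoch_cycles B 1) (hoch_chain_map 1 B \<phi>)"
proof -
  have "operator_hom (hoch_chains A 1) (hoch_chains B 1) (hoch_chain_map 1 B \<phi>)"
    unfolding A.hoch_chains_eq B.hoch_chains_eq hoch_chain_map_def Suc_1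
    by (rule operator_subgroup.quotient_map_hom[OF A.rel_subgroup B.rel_subgroup])
      (auto intro!: map_rel pm_extend_operator_hom map_tensor_lists)
  moreover have "hoch_chain_map 1 B \<phi> X \<in> carrier (hoch_cycles B 1)" if "X \<in> carrier (hoch_cycles A 1)" for X
    using that map_cycles by (auto simp: A.hoch_cycles_carrier B.hoch_cycles_carrier A.cycles1_def chain_map_cls)
  moreover have "carrier (hoch_cycles A 1) \<subseteq> carrier (hoch_chains A 1)"
    by (auto simp: hoch_cycles_def)
  ultimately show ?thesis
    by (auto simp: operator_hom_def additive_map_def hoch_cycles_def subset_iff)
qed

end

section \<open>Algebra retracts that induce isomorphisms in degree one\<close>

text \<open>
The left inverse \<open>\<pi>\<close> gives injectivity.  The last hypothesis says that \<open>h\<close> is the degree 0 part of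
a homotopy between \<open>\<phi> \<pi>\<close> and the identity: modulo boundaries \<open>f - \<phi> \<pi> f = h (d f)\<close> for all 1-chains
\<open>f\<close>.  If \<open>f\<close> is a cycle, then \<open>d f\<close> is a relation, hence so is \<open>h (d f)\<close>, and \<open>f\<close> is homologous to
\<open>\<phi> (\<pi> f)\<close>.
\<close>

lemma HH1_retract_iso:
  fixes A :: "('k::field, 'a) module" and B :: "('k, 'b) module"
  assumes A: "k_algebra A" and B: "k_algebra B"
    and \<phi>: "algebra_hom B A \<phi>" and \<pi>: "algebra_hom A B \<pi>"
    and retract: "\<And>b. b \<in> carrier B \<Longrightarrow> \<pi> (\<phi> b) = b"
    and h: "linear_mod A (tensor_rel A 2) h"
    and homotopy: "\<And>a b. a \<in> carrier A \<Longrightarrow> b \<in> carrier A \<Longrightarrow>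
        pure [a, b] - pure [\<phi> (\<pi> a), \<phi> (\<pi> b)] - (h (a \<otimes>\<^bsub>A\<^esub> b) - h (b \<otimes>\<^bsub>A\<^esub> a)) \<in> k_algebra.bounds1 A"
  shows "HH_map 1 A \<phi> \<in> linear_iso (HH 1 B) (HH 1 A)"
proof -
  interpret phi: hoch_functoriality B A \<phi>
    using A B \<phi> by (simp add: hoch_functoriality_def hoch_functoriality_axioms_def)
  interpret pi: hoch_functoriality A B \<pi>
    using A B \<pi> by (simp add: hoch_functoriality_def hoch_functoriality_axioms_def)
  let ?A = phi.B.cls and ?B = phi.A.cls
  have pi_phi: "pi.chain_map (phi.chain_map f) = f" if "f \<in> carrier (phi.A.tens n)" for f n
  proof -
    have "pi.chain_map (phi.chain_map f) = pm_extend pure f"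
      unfolding pm_extend_extend
      by (rule pm_extend_cong)
        (use that in \<open>auto simp: carrier_free_space tensor_lists_def subset_iff retract intro!: arg_cong[of _ _ pure] map_idI\<close>)
    then show ?thesis by (simp add: pm_extend_id)
  qed
  define H where "H = pm_extend (\<lambda>xs. h (hd xs))"
  have H_rel: "H f \<in> phi.B.rel 2" if "f \<in> phi.B.rel 1" for f
    unfolding H_def
    by (rule tensor_rel_universal[where A = A and n = 1]) (use h that in \<open>auto simp: One_nat_def\<close>)
  have hom: "f - phi.chain_map (pi.chain_map f) - H (phi.B.d 1 f) \<in> phi.B.bounds1"
    if f: "f \<in> carrier (phi.B.tens 2)" for f
  proof -
    have "f - phi.chain_map (pi.chain_map f) - H (phi.B.d 1 f) =
        pm_extend (\<lambda>xs. pure xs - pure (map \<phi> (map \<pi> xs)) - H (hoch_boundary A 1 xs)) f"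
      by (simp add: pm_extend_fun_diff pm_extend_id pm_extend_extend H_def)
    moreover have "\<dots> \<in> phi.B.bounds1"
      by (rule pm_extend_mem[OF phi.B.bounds1_subspace f])
        (use homotopy in \<open>auto simp: tensor_lists_cases hoch_boundary_1 pm_extend_diff H_def\<close>)
    ultimately show ?thesis by simp
  qed
  show ?thesis
    unfolding HH_map_def HH_def
  proof (rule quotient_linear_iso[OF phi.A.boundaries_subgroup phi.B.boundaries_subgroup phi.chain_map_hom])
    show "hoch_chain_map 1 A \<phi> X \<in> hoch_boundaries A 1" if "X \<in> hoch_boundaries B 1" for X
      using that by (rule phi.chain_map_boundaries)
    show "X \<in> hoch_boundaries B 1"
      if X: "X \<in> carrier (hoch_cycles B 1)" "hoch_chain_map 1 A \<phi> X \<in> hoch_boundaries A 1" for X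
    proof -
      obtain f where f: "f \<in> phi.A.cycles1" "X = ?B f" using X phi.A.hoch_cycles_carrier by auto
      then have f2: "f \<in> carrier (phi.A.tens 2)" by (simp add: phi.A.cycles1_def)
      then have "phi.chain_map f \<in> phi.B.bounds1"
        using X(2) f by (simp add: phi.chain_map_cls phi.B.cls_mem_boundaries phi.map_free)
      then have "pi.chain_map (phi.chain_map f) \<in> phi.A.bounds1" by (rule pi.map_bounds)
      then show ?thesis using f f2 by (simp add: pi_phi phi.A.cls_mem_boundaries)
    qed
    show "\<exists>X\<in>carrier (hoch_cycles B 1).
        hoch_boundaries A 1 +>\<^bsub>hoch_cycles A 1\<^esub> hoch_chain_map 1 A \<phi> X = hoch_boundaries A 1 +>\<^bsub>hoch_cycles A 1\<^esub> Y"
      if Y: "Y \<in> carrier (hoch_cycles A 1)" for Y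
    proof -
      interpret Z: operator_subgroup "hoch_boundaries A 1" "hoch_cycles A 1"
        by (rule phi.B.boundaries_subgroup)
      interpret T: operator_subgroup "phi.B.rel 2" "phi.B.tens 2" by (rule phi.B.rel_subgroup)
      obtain f where f: "f \<in> phi.B.cycles1" "Y = ?A f" using Y phi.B.hoch_cycles_carrier by auto
      then have f2: "f \<in> carrier (phi.B.tens 2)" and d: "phi.B.d 1 f \<in> phi.B.rel 1"
        by (auto simp: phi.B.cycles1_def)
      define X where "X = ?B (pi.chain_map f)"
      have pf: "pi.chain_map f \<in> phi.A.cycles1" using f(1) by (rule pi.map_cycles)
      then have X: "X \<in> carrier (hoch_cycles B 1)"
        unfolding X_def phi.A.hoch_cycles_carrier by (rule imageI)
      define g where "g = phi.chain_map (pi.chain_map f)"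
      have g: "g \<in> carrier (phi.B.tens 2)" "g \<in> phi.B.cycles1"
        unfolding g_def using f2 pf by (auto intro!: phi.map_free pi.map_free phi.map_cycles)
      have gX: "hoch_chain_map 1 A \<phi> X = ?A g"
        unfolding X_def g_def using pi.map_free[OF f2] by (rule phi.chain_map_cls)
      have "f - g \<in> phi.B.bounds1"
      proof -
        have "f - g = (f - g - H (phi.B.d 1 f)) + H (phi.B.d 1 f)" by simp
        moreover have "H (phi.B.d 1 f) \<in> phi.B.bounds1" using H_rel[OF d] phi.B.rel_bounds1 by blast
        ultimately show ?thesis
          using hom[OF f2] pm.subspace_add[OF phi.B.bounds1_subspace] unfolding g_def by metis
      qed
      moreover have fg: "f - g \<in> carrier (phi.B.tens 2)"
        using f2 g(1) by (rule pm.subspace_diff[OF subspace_free_space])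
      ultimately have m: "?A (f - g) \<in> hoch_boundaries A 1"
        by (simp add: phi.B.cls_mem_boundaries)
      have "Y = ?A (f - g) \<oplus>\<^bsub>hoch_cycles A 1\<^esub> ?A g"
        using T.quotient_add[OF fg g(1)] f(2)
        by (simp add: hoch_cycles_def phi.B.hoch_chains_eq)
      then have "Y \<in> hoch_boundaries A 1 +>\<^bsub>hoch_cycles A 1\<^esub> ?A g"
        using m by (auto simp: a_r_coset_def')
      moreover have "?A g \<in> carrier (hoch_cycles A 1)"
        unfolding phi.B.hoch_cycles_carrier using g by blast
      ultimately show ?thesis
        using Z.a_repr_independence[OF _ _ Z.a_subgroup] X gX by metis
    qed
  qed
qed

context k_algebra
begin

context
  fixes \<rho> :: "'a \<Rightarrow> 'a" and h :: "'a \<Rightarrow> 'a list \<Rightarrow>\<^sub>0 'k"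
  assumes \<rho>: "algebra_hom A A \<rho>" and h: "linear_mod A (rel 2) h"
begin

text \<open>
Think of \<open>\<rho>\<close> as the idempotent endomorphism \<open>\<phi> \<pi>\<close> of \<open>A\<close> attached to a retraction.
\<close>

definition homotopy_error :: "'a \<Rightarrow> 'a \<Rightarrow> 'a list \<Rightarrow>\<^sub>0 'k" where
  "homotopy_error a b = pure [a, b] - pure [\<rho> a, \<rho> b] - (h (a \<otimes> b) - h (b \<otimes> a))"

lemma homotopy_error_linear:
  assumes a: "a \<in> carrier A"
  shows "linear_mod A bounds1 (\<lambda>x. homotopy_error a x)" "linear_mod A bounds1 (\<lambda>x. homotopy_error x a)"
proof -
  have \<rho>h: "operator_hom A A \<rho>" using \<rho> by (simp add: algebra_hom_def)
  note intros = linear_mod_diff linear_mod_mono[OF _ rel_bounds1] tensor_rel_subspace bounds1_subspace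
    linear_mod_comp[OF mult_hom(1) h] linear_mod_comp[OF mult_hom(2) h] pure_linear_2
    linear_mod_comp[OF \<rho>h pure_linear_2(1)] linear_mod_comp[OF \<rho>h pure_linear_2(2)]
    algebra_hom_closed[OF \<rho>] a
  show "linear_mod A bounds1 (\<lambda>x. homotopy_error a x)" "linear_mod A bounds1 (\<lambda>x. homotopy_error x a)"
    unfolding homotopy_error_def by (rule linear_mod_mono[OF _ rel_bounds1], intro intros)+
qed

text \<open>
Modulo the boundaries of \<open>a \<otimes> b \<otimes> c\<close> and of its image under \<open>\<rho>\<close>, the first two terms of the error
are additive under replacing \<open>a \<otimes> bc\<close> by \<open>ab \<otimes> c + ca \<otimes> b\<close>.  So are the others, because the commutator
of \<open>a\<close> with \<open>bc\<close> is the sum of those of \<open>ab\<close> with \<open>c\<close> and of \<open>ca\<close> with \<open>b\<close>.  Hence errors on a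
product are controlled by errors on its factors.
\<close>

lemma homotopy_error_mult:
  assumes a: "a \<in> carrier A" and b: "b \<in> carrier A" and c: "c \<in> carrier A"
  shows "homotopy_error (a \<otimes> b) c \<in> bounds1 \<Longrightarrow> homotopy_error (c \<otimes> a) b \<in> bounds1 \<Longrightarrow>
    homotopy_error a (b \<otimes> c) \<in> bounds1"
proof -
  assume *: "homotopy_error (a \<otimes> b) c \<in> bounds1" "homotopy_error (c \<otimes> a) b \<in> bounds1"
  note cl = algebra_hom_closed[OF \<rho>]
  define D :: "'a \<Rightarrow> 'a \<Rightarrow> 'a \<Rightarrow> 'a list \<Rightarrow>\<^sub>0 'k"
    where "D a b c = pure [a \<otimes> b, c] - pure [a, b \<otimes> c] + pure [c \<otimes> a, b]" for a b c
  have D: "D x y z \<in> bounds1" if "x \<in> carrier A" "y \<in> carrier A" "z \<in> carrier A" for x y z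
    unfolding D_def using that by (rule d2_bounds1)
  have \<rho>m: "\<rho> (x \<otimes> y) = \<rho> x \<otimes> \<rho> y" if "x \<in> carrier A" "y \<in> carrier A" for x y
    using \<rho> that by (simp add: algebra_hom_def)
  have "homotopy_error a (b \<otimes> c) =
      homotopy_error (a \<otimes> b) c + homotopy_error (c \<otimes> a) b - (D a b c - D (\<rho> a) (\<rho> b) (\<rho> c))"
    unfolding homotopy_error_def D_def using a b c by (simp add: m_assoc \<rho>m)
  then show ?thesis
    using * D cl a b c by (simp add: pm.subspace_add pm.subspace_diff)
qed

end
end

section \<open>Path algebras\<close>

lemma path_algebra_sel [simp]:
  "f \<oplus>\<^bsub>path_algebra Q\<^esub> g = f + g" "\<zero>\<^bsub>path_algebra Q\<^esub> = 0" "c \<odot>\<^bsub>path_algebra Q\<^esub> f = pm_scale c f"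
  by (simp_all add: path_algebra_def)

lemma path_algebra_carrier: "carrier (path_algebra Q) = carrier (free_space (paths Q))"
  by (simp add: path_algebra_def free_space_def)

lemma path_elem_carrier [simp]: "path_elem \<alpha> \<in> carrier (path_algebra Q :: ('k::field, _) module) \<longleftrightarrow> \<alpha> \<in> paths Q"
  by (simp add: path_algebra_carrier path_elem_def)

lemma path_algebra_mult: "f \<otimes>\<^bsub>path_algebra Q\<^esub> g = pm_extend (\<lambda>\<beta>. pm_extend (path_mult Q \<beta>) g) f"
  by (simp add: path_algebra_def)

lemma path_elem_mult [simp]: "path_elem \<beta> \<otimes>\<^bsub>path_algebra Q\<^esub> path_elem \<alpha> = path_mult Q \<beta> \<alpha>"
  by (simp add: path_algebra_mult path_elem_def)

lemma path_algebra_k_algebra: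
  assumes "fin_digraph Q"
  shows "k_algebra (path_algebra Q :: ('k::field, ('v, 'e) path \<Rightarrow>\<^sub>0 'k) module)"
proof -
  have swap: "pm_extend (\<lambda>\<beta>. pm_scale c (G \<beta>)) f = pm_scale c (pm_extend G f)"
    for c :: 'k and G :: "('v, 'e) path \<Rightarrow> ('v, 'e) path \<Rightarrow>\<^sub>0 'k" and f :: "('v, 'e) path \<Rightarrow>\<^sub>0 'k"
    by (simp add: pm_extend_def pm.scale_sum_right mult.commute)
  show ?thesis
    by (intro k_algebra.intro k_algebra_axioms.intro ring_path_algebra assms)
      (simp_all add: path_algebra_carrier pm.subspace_scale subspace_free_space pm.scale_right_distrib
        path_algebra_mult pm_extend_scale swap)
qed

lemma path_algebra_induct [consumes 1, case_names zero add scale path]: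
  assumes f: "f \<in> carrier (path_algebra Q)" and "P 0"
    and add: "\<And>f g. f \<in> carrier (path_algebra Q) \<Longrightarrow> g \<in> carrier (path_algebra Q) \<Longrightarrow> P f \<Longrightarrow> P g \<Longrightarrow> P (f + g)"
    and scale: "\<And>c f. f \<in> carrier (path_algebra Q) \<Longrightarrow> P f \<Longrightarrow> P (pm_scale c f)"
    and path: "\<And>\<alpha>. \<alpha> \<in> paths Q \<Longrightarrow> P (path_elem \<alpha>)"
  shows "P f"
proof -
  let ?R = "{f \<in> carrier (path_algebra Q). P f}"
  note sp = subspace_free_space[of "paths Q"]
  have "pm.subspace ?R"
    by (intro pm.subspaceI)
      (use assms pm.subspace_0[OF sp] pm.subspace_add[OF sp] pm.subspace_scale[OF sp] in
        \<open>auto simp: path_algebra_carrier\<close>)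
  moreover have "f = pm_extend path_elem f" by (simp add: path_elem_def[abs_def] pm_extend_id)
  moreover have "pm_extend path_elem f \<in> ?R"
    by (rule pm_extend_mem[OF _ f[unfolded path_algebra_carrier]])
      (use calculation path in \<open>auto\<close>)
  ultimately show ?thesis by simp
qed

text \<open>
Paths span the path algebra.
\<close>

lemma linear_mod_path_algebra:
  assumes R: "pm.subspace R" and Q: "fin_digraph Q" and F: "linear_mod (path_algebra Q) R F"
    and "f \<in> carrier (path_algebra Q)" "\<And>\<alpha>. \<alpha> \<in> paths Q \<Longrightarrow> F (path_elem \<alpha>) \<in> R"
  shows "F f \<in> R"
  using assms(4)
proof (induction rule: path_algebra_induct)
  case zero
  interpret k_algebra "path_algebra Q" using Q by (rule path_algebra_k_algebra)
  show ?case using linear_mod_zero[OF op_group R F] by simp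
next
  case (add f g)
  then show ?case using linear_mod_kernel(1)[OF R F, of f g] by simp
next
  case (scale c f)
  then show ?case using linear_mod_kernel(2)[OF R F, of f c] by simp
qed fact

lemma path_algebra_homI:
  fixes g :: "('v, 'e) path \<Rightarrow> (('w, 'f) path \<Rightarrow>\<^sub>0 'k::field)"
  assumes Q: "fin_digraph Q" and Q': "fin_digraph Q'"
    and closed: "\<And>\<alpha>. \<alpha> \<in> paths Q \<Longrightarrow> g \<alpha> \<in> carrier (path_algebra Q')"
    and mult: "\<And>\<alpha> \<beta>. \<alpha> \<in> paths Q \<Longrightarrow> \<beta> \<in> paths Q \<Longrightarrow>
        pm_extend g (path_mult Q \<beta> \<alpha>) = g \<beta> \<otimes>\<^bsub>path_algebra Q'\<^esub> g \<alpha>"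
  shows "algebra_hom (path_algebra Q) (path_algebra Q') (pm_extend g)"
proof -
  interpret A: k_algebra "path_algebra Q :: ('k, ('v, 'e) path \<Rightarrow>\<^sub>0 'k) module" using Q by (rule path_algebra_k_algebra)
  interpret B: k_algebra "path_algebra Q' :: ('k, ('w, 'f) path \<Rightarrow>\<^sub>0 'k) module" using Q' by (rule path_algebra_k_algebra)
  let ?A = "path_algebra Q :: ('k, ('v, 'e) path \<Rightarrow>\<^sub>0 'k) module"
    and ?B = "path_algebra Q' :: ('k, ('w, 'f) path \<Rightarrow>\<^sub>0 'k) module"
  have c: "f \<in> carrier ?A \<Longrightarrow> pm_extend g f \<in> carrier ?B" for f
    using pm_extend_mem[OF subspace_free_space, of f "paths Q" g] closed
    by (simp add: path_algebra_carrier)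
  have ge: "pm_extend g (path_elem \<alpha>) = g \<alpha>" for \<alpha> by (simp add: path_elem_def)
  have m1: "pm_extend g (path_elem \<beta> \<otimes>\<^bsub>?A\<^esub> f) = pm_extend g (path_elem \<beta>) \<otimes>\<^bsub>?B\<^esub> pm_extend g f"
    if "f \<in> carrier ?A" "\<beta> \<in> paths Q" for f \<beta>
    using that(1)
  proof (induction rule: path_algebra_induct)
    case zero show ?case using that(2) closed A.r_null[of "path_elem \<beta>"] B.r_null by (simp add: ge)
  next
    case (add f f')
    then show ?case using that(2) A.r_distr[of f f' "path_elem \<beta>"] 
        B.r_distr[of "pm_extend g f" "pm_extend g f'" "g \<beta>"] c closed by (simp add: ge pm_extend_add)
  next
    case (scale r f)
    then show ?case using that(2) A.smult_mult_right[of "path_elem \<beta>" f r]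
        B.smult_mult_right[of "g \<beta>" "pm_extend g f" r] c closed by (simp add: ge pm_extend_scale)
  next
    case (path \<alpha>) then show ?case using that(2) mult by (simp add: ge)
  qed
  have "pm_extend g (e \<otimes>\<^bsub>?A\<^esub> f) = pm_extend g e \<otimes>\<^bsub>?B\<^esub> pm_extend g f"
    if "e \<in> carrier ?A" "f \<in> carrier ?A" for e f
    using that(1)
  proof (induction rule: path_algebra_induct)
    case zero show ?case using that(2) A.l_null[of f] B.l_null[OF c[OF that(2)]] by simp
  next
    case (add e e')
    then show ?case using that(2) A.l_distr[of e e' f] 
        B.l_distr[of "pm_extend g e" "pm_extend g e'" "pm_extend g f"] c by (simp add: pm_extend_add)
  next
    case (scale r e)
    then show ?case using that(2) A.smult_mult_left[of e f r]
        B.smult_mult_left[of "pm_extend g e" "pm_extend g f" r] c by (simp add: pm_extend_scale)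
  next
    case (path \<alpha>) then show ?case using that(2) m1 by simp
  qed
  then show ?thesis using c
    by (simp add: algebra_hom_def operator_hom_def additive_map_def pm_extend_add pm_extend_scale)
qed

context fin_digraph
begin

lemma paths_Nil [simp]: "(u, []) \<in> paths G \<longleftrightarrow> u \<in> verts G"
  by (auto simp: paths_def awalk_Nil_iff)

lemma paths_Cons [simp]: "(u, e # p) \<in> paths G \<longleftrightarrow> e \<in> arcs G \<and> tail G e = u \<and> (head G e, p) \<in> paths G"
  by (auto simp: paths_def awalk_Cons_iff)

lemma path_target_Nil [simp]: "path_target G (u, []) = u"
  by (simp add: path_target_def awalk_verts.simps)

lemma path_target_Cons [simp]: "path_target G (u, e # p) = path_target G (head G e, p)"
  by (simp add: path_target_def awalk_verts.simps awalk_verts_non_Nil)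

lemma paths_source: "(u, p) \<in> paths G \<Longrightarrow> u \<in> verts G"
  by (auto simp: paths_def awalk_def)

lemma paths_append: "(u, p @ q) \<in> paths G \<longleftrightarrow> (u, p) \<in> paths G \<and> (path_target G (u, p), q) \<in> paths G"
  by (induction p arbitrary: u) (auto dest: paths_source)

lemma paths_target: "(u, p) \<in> paths G \<Longrightarrow> path_target G (u, p) \<in> verts G"
  by (induction p arbitrary: u) auto

end

section \<open>The algebra with the new arrows, and its retraction\<close>

lemma pm_extend_path_elem [simp]: "pm_extend g (path_elem \<alpha>) = g \<alpha>"
  by (simp add: path_elem_def)

locale arrow_extension = Q: fin_digraph Q
  for Q :: "('v, 'e) pre_digraph" +
  fixes I :: "(('v, 'e) path \<Rightarrow>\<^sub>0 'k::field) set"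
    and F :: "'f set" and sF tF :: "'f \<Rightarrow> 'v"
  assumes I: "ideal I (path_algebra Q)"
    and F: "new_arrows Q F sF tF"
begin

abbreviation "QF \<equiv> add_arrows Q F sF tF"
abbreviation PQ :: "('k, ('v, 'e) path \<Rightarrow>\<^sub>0 'k) module" where "PQ \<equiv> path_algebra Q"
abbreviation PF :: "('k, ('v, 'e + 'f) path \<Rightarrow>\<^sub>0 'k) module" where "PF \<equiv> path_algebra QF"
abbreviation "J \<equiv> ext_ideal Q I F sF tF"
abbreviation "BF \<equiv> ext_algebra Q I F sF tF"
abbreviation old :: "('v, 'e) path \<Rightarrow> ('v, 'e + 'f) path" where "old \<alpha> \<equiv> (fst \<alpha>, map Inl (snd \<alpha>))"

lemma QF_sel [simp]: "verts QF = verts Q" "arcs QF = Inl ` arcs Q \<union> Inr ` F"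
  "tail QF (Inl e) = tail Q e" "tail QF (Inr x) = sF x" "head QF (Inl e) = head Q e" "head QF (Inr x) = tF x"
  by (simp_all add: add_arrows_def)

sublocale QF: fin_digraph QF
  by unfold_locales (use F in \<open>auto simp: new_arrows_def\<close>)

sublocale PQ: k_algebra PQ by (rule path_algebra_k_algebra[OF Q.fin_digraph_axioms])
sublocale PF: k_algebra PF by (rule path_algebra_k_algebra[OF QF.fin_digraph_axioms])

lemma PF_a_inv: "\<ominus>\<^bsub>PF\<^esub> f = - f" if "f \<in> carrier PF"
  using PF.minus_equality[of "-f" f] that pm.subspace_neg[OF subspace_free_space, of f]
  by (simp add: path_algebra_carrier)

lemma old_path [simp]: "(u, map Inl p) \<in> paths QF \<longleftrightarrow> (u, p) \<in> paths Q"
  by (induction p arbitrary: u) auto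

lemma old_target [simp]: "path_target QF (u, map Inl p) = path_target Q (u, p)"
  by (induction p arbitrary: u) auto

lemma path_incl_elem [simp]: "path_incl (path_elem \<alpha>) = (path_elem (old \<alpha>) :: ('v, 'e + 'f) path \<Rightarrow>\<^sub>0 'k)"
  by (simp add: path_incl_def path_elem_def split_beta)

lemma path_incl_hom: "algebra_hom PQ PF path_incl"
  unfolding path_incl_def
proof (rule path_algebra_homI[OF Q.fin_digraph_axioms QF.fin_digraph_axioms], goal_cases)
  case (1 \<alpha>) then show ?case by (cases \<alpha>) simp
next
  case (2 \<alpha> \<beta>) 
  then show ?case by (cases \<alpha>; cases \<beta>) (auto simp: path_mult_def)
qed

definition kill_new :: "(('v, 'e + 'f) path \<Rightarrow>\<^sub>0 'k) \<Rightarrow> (('v, 'e) path \<Rightarrow>\<^sub>0 'k)" where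
  "kill_new = pm_extend (\<lambda>(u, p). if list_all isl p then path_elem (u, map projl p) else 0)"

lemma all_old: "list_all isl p \<Longrightarrow> \<exists>r. p = map Inl r"
proof (induction p)
  case (Cons e p)
  then show ?case by (cases e) (auto intro: exI[of _ "_ # _"])
qed simp

lemma map_projl_comp_Inl [simp]: "map (projl \<circ> Inl) p = p"
  by (induction p) auto

lemma list_all_isl_Inl [simp]: "list_all isl (map Inl p)"
  by (induction p) auto

lemma kill_new_elem:
  "kill_new (path_elem (u, p)) = (if list_all isl p then path_elem (u, map projl p) else 0)"
  by (simp add: kill_new_def path_elem_def)

lemma kill_new_hom: "algebra_hom PF PQ kill_new"
  unfolding kill_new_def
proof (rule path_algebra_homI[OF QF.fin_digraph_axioms Q.fin_digraph_axioms], goal_cases)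
  case (1 \<alpha>)
  have "0 \<in> carrier PQ" using PQ.zero_closed by simp
  with 1 show ?case by (cases \<alpha>) (auto dest!: all_old)
next
  case (2 \<alpha> \<beta>)
  obtain u p v q where [simp]: "\<alpha> = (u, p)" "\<beta> = (v, q)" by (metis surj_pair)
  have "0 \<otimes>\<^bsub>PQ\<^esub> f = 0" "f \<otimes>\<^bsub>PQ\<^esub> 0 = 0" for f by (simp_all add: path_algebra_mult pm_extend_def)
  then show ?case using 2
    by (auto dest!: all_old simp: path_mult_def)
qed

lemma kill_new_incl: "f \<in> carrier PQ \<Longrightarrow> kill_new (path_incl f) = f"
proof -
  assume f: "f \<in> carrier PQ"
  have "kill_new (path_incl f) = pm_extend (\<lambda>\<alpha>. Poly_Mapping.single \<alpha> 1) f"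
    unfolding path_incl_def kill_new_def pm_extend_extend
    by (rule pm_extend_cong) (auto simp: path_elem_def split_beta comp_def)
  then show ?thesis by (simp add: pm_extend_id)
qed

lemma incl_closed [simp]: "f \<in> carrier PQ \<Longrightarrow> path_incl f \<in> carrier PF"
  by (rule algebra_hom_closed[OF path_incl_hom])

lemma incl_mult [simp]:
  "f \<in> carrier PQ \<Longrightarrow> g \<in> carrier PQ \<Longrightarrow> path_incl (f \<otimes>\<^bsub>PQ\<^esub> g) = path_incl f \<otimes>\<^bsub>PF\<^esub> path_incl g"
  using path_incl_hom by (simp add: algebra_hom_def)

lemma I_carrier: "f \<in> I \<Longrightarrow> f \<in> carrier PQ"
  using ideal.axioms(1)[OF I] additive_subgroup.a_subset by blast

lemma J: "ideal J PF" and incl_J: "f \<in> I \<Longrightarrow> path_incl f \<in> J"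
  and J_minimal: "ideal K PF \<Longrightarrow> path_incl ` I \<subseteq> K \<Longrightarrow> J \<subseteq> K"
proof -
  have sub: "path_incl ` I \<subseteq> carrier PF" using I_carrier by auto
  show "ideal J PF" "f \<in> I \<Longrightarrow> path_incl f \<in> J"
    unfolding ext_ideal_def using PF.genideal_ideal[OF sub] PF.genideal_self[OF sub] by auto
  show "ideal K PF \<Longrightarrow> path_incl ` I \<subseteq> K \<Longrightarrow> J \<subseteq> K"
    unfolding ext_ideal_def by (rule PF.genideal_minimal)
qed

sublocale J: ideal J PF by (rule J)

text \<open>
The preimage of \<open>I\<close> is an ideal containing the generators of \<open>J\<close>.
\<close>

lemma kill_new_J: "f \<in> J \<Longrightarrow> kill_new f \<in> I"
proof -
  have "J \<subseteq> {f \<in> carrier PF. kill_new f \<in> I}"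
    by (rule J_minimal[OF preimage_ideal[OF PF.k_algebra_axioms PQ.k_algebra_axioms kill_new_hom I]])
      (auto simp: kill_new_incl I_carrier)
  then show "f \<in> J \<Longrightarrow> kill_new f \<in> I" by auto
qed

sublocale BF: k_algebra BF
  unfolding ext_algebra_def quiver_algebra_def by (rule PF.quotient_k_algebra[OF J])

abbreviation q :: "(('v, 'e + 'f) path \<Rightarrow>\<^sub>0 'k) \<Rightarrow> (('v, 'e + 'f) path \<Rightarrow>\<^sub>0 'k) set" where
  "q f \<equiv> J +>\<^bsub>PF\<^esub> f"

sublocale JS: operator_subgroup J PF by (rule PF.ideal_operator_subgroup[OF J])

lemma q_hom: "algebra_hom PF BF (\<lambda>f. q f)"
  unfolding ext_algebra_def quiver_algebra_def by (rule PF.quotient_proj_hom[OF J])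

lemma q_ohom: "operator_hom PF BF (\<lambda>f. q f)"
  using q_hom by (simp add: algebra_hom_def)

lemma BF_carrier: "carrier BF = (\<lambda>f. q f) ` carrier PF"
  unfolding ext_algebra_def quiver_algebra_def by (rule JS.quotient_carrier)

lemma q_closed [simp]: "f \<in> carrier PF \<Longrightarrow> q f \<in> carrier BF"
  using q_hom by (rule algebra_hom_closed)

lemma q_mult [simp]:
  "f \<in> carrier PF \<Longrightarrow> g \<in> carrier PF \<Longrightarrow> q f \<otimes>\<^bsub>BF\<^esub> q g = q (f \<otimes>\<^bsub>PF\<^esub> g)"
  using q_hom by (simp add: algebra_hom_def)

lemma q_zero: "f \<in> J \<Longrightarrow> q f = \<zero>\<^bsub>BF\<^esub>"
  unfolding ext_algebra_def quiver_algebra_def JS.quotient_zero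
  using J.a_subset JS.coset_eq_self_iff by auto

abbreviation "T \<equiv> tensor_rel BF 2"

lemma pure_zero: "X \<in> carrier BF \<Longrightarrow> pure [\<zero>\<^bsub>BF\<^esub>, X] \<in> T" "X \<in> carrier BF \<Longrightarrow> pure [X, \<zero>\<^bsub>BF\<^esub>] \<in> T"
  by (rule linear_mod_zero[OF BF.op_group tensor_rel_subspace BF.pure_linear_2(2)], assumption)
    (rule linear_mod_zero[OF BF.op_group tensor_rel_subspace BF.pure_linear_2(1)], assumption)

section \<open>Cutting a path at its first new arrow\<close>

definition before_new :: "('v, 'e + 'f) path \<Rightarrow> ('v, 'e + 'f) path" where
  "before_new \<alpha> = (fst \<alpha>, takeWhile isl (snd \<alpha>))"

definition from_new :: "('v, 'e + 'f) path \<Rightarrow> ('v, 'e + 'f) path" where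
  "from_new \<alpha> = (path_target QF (before_new \<alpha>), dropWhile isl (snd \<alpha>))"

text \<open>
The map \<open>h\<close> of the introduction, on the path algebra.  The second factor is the initial segment
because products of paths are read from right to left.
\<close>

definition first_cut :: "(('v, 'e + 'f) path \<Rightarrow>\<^sub>0 'k) \<Rightarrow> ((('v, 'e + 'f) path \<Rightarrow>\<^sub>0 'k) set list \<Rightarrow>\<^sub>0 'k)" where
  "first_cut = pm_extend (\<lambda>\<alpha>. if list_all isl (snd \<alpha>) then 0
     else pure [q (path_elem (from_new \<alpha>)), q (path_elem (before_new \<alpha>))])"

lemma cut_elem: "first_cut (path_elem \<alpha>) = (if list_all isl (snd \<alpha>) then 0
     else pure [q (path_elem (from_new \<alpha>)), q (path_elem (before_new \<alpha>))])"
  by (simp add: first_cut_def path_elem_def)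

lemma cut_linear: "pm.subspace R \<Longrightarrow> linear_mod PF R first_cut"
  by (rule linear_mod_exact) (simp_all add: first_cut_def pm_extend_add pm_extend_scale)

lemma cut_paths:
  assumes "\<alpha> \<in> paths QF"
  shows "before_new \<alpha> \<in> paths QF" "from_new \<alpha> \<in> paths QF" "path_target QF (before_new \<alpha>) = fst (from_new \<alpha>)"
    "path_target QF (from_new \<alpha>) = path_target QF \<alpha>"
    "path_elem (from_new \<alpha>) \<otimes>\<^bsub>PF\<^esub> path_elem (before_new \<alpha>) = (path_elem \<alpha> :: ('v, 'e + 'f) path \<Rightarrow>\<^sub>0 'k)"
proof -
  have "(fst \<alpha>, takeWhile isl (snd \<alpha>) @ dropWhile isl (snd \<alpha>)) \<in> paths QF" using assms by simp
  then show "before_new \<alpha> \<in> paths QF" "from_new \<alpha> \<in> paths QF"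
    by (simp_all only: QF.paths_append before_new_def from_new_def fst_conv snd_conv)
  show "path_target QF (before_new \<alpha>) = fst (from_new \<alpha>)" by (simp add: from_new_def)
  show "path_target QF (from_new \<alpha>) = path_target QF \<alpha>"
    unfolding from_new_def before_new_def
    by (simp flip: path_target_append)
  show "path_elem (from_new \<alpha>) \<otimes>\<^bsub>PF\<^esub> path_elem (before_new \<alpha>) = (path_elem \<alpha> :: ('v, 'e + 'f) path \<Rightarrow>\<^sub>0 'k)"
    by (simp add: path_mult_def) (simp add: from_new_def before_new_def)
qed

lemma mult_zero [simp]: "0 \<otimes>\<^bsub>PF\<^esub> f = 0" "f \<otimes>\<^bsub>PF\<^esub> 0 = 0"
  by (simp_all add: path_algebra_mult pm_extend_def)

lemma cut_0 [simp]: "first_cut 0 = 0" by (simp add: first_cut_def)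

lemma q_0: "q 0 = \<zero>\<^bsub>BF\<^esub>"
  by (rule q_zero) (metis J.zero_closed path_algebra_sel(2))

lemma q_carrier_0 [simp]: "q 0 \<in> carrier BF" using PF.zero_closed by (intro q_closed) simp

text \<open>
Whatever follows \<open>\<beta>\<close> lies beyond the first new arrow, hence on the left of the cut.
\<close>

lemma cut_mult_path:
  assumes \<beta>: "\<beta> \<in> paths QF" "\<not> list_all isl (snd \<beta>)" and f: "f \<in> carrier PF"
  shows "first_cut (f \<otimes>\<^bsub>PF\<^esub> path_elem \<beta>)
      - pure [q (f \<otimes>\<^bsub>PF\<^esub> path_elem (from_new \<beta>)), q (path_elem (before_new \<beta>))] \<in> T"
    (is "?F f \<in> T")
proof (rule linear_mod_path_algebra[OF tensor_rel_subspace QF.fin_digraph_axioms _ f, of _ _ ?F])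
  note cp = cut_paths[OF \<beta>(1)]
  show "linear_mod PF T ?F"
    by (intro linear_mod_diff tensor_rel_subspace linear_mod_comp[OF PF.mult_hom(2) cut_linear]
       linear_mod_comp[OF PF.mult_hom(2) linear_mod_comp[OF q_ohom BF.pure_linear_2(2)]])
      (use \<beta> cp in simp_all)
  fix \<alpha> assume \<alpha>: "\<alpha> \<in> paths QF"
  show "?F (path_elem \<alpha>) \<in> T"
  proof (cases "path_target QF \<beta> = fst \<alpha>")
    case True
    obtain y where "y \<in> set (snd \<beta>)" "\<not> isl y" using \<beta>(2) by (auto simp: list_all_iff)
    then have "before_new (fst \<beta>, snd \<beta> @ snd \<alpha>) = before_new \<beta>"
      "dropWhile isl (snd \<beta> @ snd \<alpha>) = snd (from_new \<beta>) @ snd \<alpha>"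
      by (simp_all add: before_new_def from_new_def takeWhile_append dropWhile_append)
       (use \<open>y \<in> set _\<close> \<open>\<not> isl y\<close> in auto)
    then show ?thesis using True \<beta>(2)
      by (simp add: path_mult_def cut_elem cp pm.subspace_0)
        (simp add: from_new_def pm.subspace_0)
  next
    case False
    then show ?thesis using pure_zero(1)[of "q (path_elem (before_new \<beta>))"] cp
      by (simp add: path_mult_def q_0 pm.subspace_neg)
  qed
qed

text \<open>
Old arrows in front of \<open>\<alpha>\<close> are traversed before the first new arrow, hence lie on the right of the cut.
\<close>

lemma cut_path_mult:
  assumes \<alpha>: "\<alpha> \<in> paths QF" "\<not> list_all isl (snd \<alpha>)" and f: "f \<in> carrier PQ"
  shows "first_cut (path_elem \<alpha> \<otimes>\<^bsub>PF\<^esub> path_incl f)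
      - pure [q (path_elem (from_new \<alpha>)), q (path_elem (before_new \<alpha>) \<otimes>\<^bsub>PF\<^esub> path_incl f)] \<in> T"
    (is "?F f \<in> T")
proof (rule linear_mod_path_algebra[OF tensor_rel_subspace Q.fin_digraph_axioms _ f, of _ _ ?F])
  note cp = cut_paths[OF \<alpha>(1)]
  have ih: "operator_hom PQ PF path_incl" using path_incl_hom by (simp add: algebra_hom_def)
  show "linear_mod PQ T ?F"
    by (intro linear_mod_diff tensor_rel_subspace linear_mod_comp[OF ih linear_mod_comp[OF PF.mult_hom(1) cut_linear]]
       linear_mod_comp[OF ih linear_mod_comp[OF PF.mult_hom(1) linear_mod_comp[OF q_ohom BF.pure_linear_2(1)]]])
      (use \<alpha> cp in simp_all)
  fix \<beta> assume \<beta>: "\<beta> \<in> paths Q"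
  obtain v r where vr: "\<beta> = (v, r)" by (cases \<beta>)
  show "?F (path_elem \<beta>) \<in> T"
  proof (cases "path_target Q \<beta> = fst \<alpha>")
    case True
    let ?\<gamma> = "(v, map Inl r @ snd \<alpha>)"
    have b: "before_new ?\<gamma> = (v, map Inl r @ snd (before_new \<alpha>))"
      by (simp add: before_new_def takeWhile_append list_all_iff)
    have "path_target QF (v, map Inl r @ snd (before_new \<alpha>)) = path_target QF (before_new \<alpha>)"
      unfolding path_target_append using True by (simp add: vr before_new_def)
    then have "from_new ?\<gamma> = from_new \<alpha>"
      by (simp add: from_new_def b dropWhile_append list_all_iff)
    moreover have "fst (before_new \<alpha>) = fst \<alpha>" by (simp add: before_new_def)
    ultimately show ?thesis using True \<alpha>(2) b
      by (simp add: path_mult_def cut_elem vr pm.subspace_0)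
  next
    case False
    moreover have "fst (before_new \<alpha>) = fst \<alpha>" by (simp add: before_new_def)
    ultimately show ?thesis using pure_zero(2)[of "q (path_elem (from_new \<alpha>))"] cp
      by (simp add: path_mult_def q_0 pm.subspace_neg vr)
  qed
qed

lemma cut_incl: "first_cut (path_incl f) = 0"
  unfolding first_cut_def path_incl_def pm_extend_extend
  by (subst pm_extend_cong[of _ _ "\<lambda>_. 0"]) (auto simp: path_elem_def pm_extend_def)

lemma old_or_new: "\<exists>\<beta>. \<alpha> = old \<beta>" if "list_all isl (snd \<alpha>)" for \<alpha> :: "('v, 'e + 'f) path"
  using all_old[OF that] by (metis fst_conv prod.collapse snd_conv)

text \<open>
It suffices to treat products \<open>\<alpha> i \<beta>\<close> with paths \<open>\<alpha>\<close>, \<open>\<beta>\<close> and \<open>i\<close> in \<open>I\<close>.  If \<open>\<beta>\<close> passes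
through a new arrow, the cut is inside \<open>\<beta>\<close> and \<open>i\<close> ends up in the left factor.  Otherwise, if \<open>\<alpha>\<close> does,
the cut is inside \<open>\<alpha>\<close> and \<open>i\<close> ends up in the right factor.  In the remaining case there is no cut.
\<close>

lemma cut_J: "f \<in> J \<Longrightarrow> first_cut f \<in> T"
proof -
  \<comment> \<open>Requiring the property for all products on both sides makes this set an ideal, so that only generators have to be tested.\<close>
  let ?K = "{f \<in> carrier PF. \<forall>a\<in>carrier PF. \<forall>b\<in>carrier PF. first_cut (a \<otimes>\<^bsub>PF\<^esub> f \<otimes>\<^bsub>PF\<^esub> b) \<in> T}"
  have cut_add: "first_cut (f + g) = first_cut f + first_cut g" and cut_neg: "first_cut (- f) = - first_cut f" for f g
    by (simp_all add: first_cut_def pm_extend_add pm_extend_neg)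
  have K: "ideal ?K PF"
  proof (rule idealI[OF PF.ring_axioms])
    show "subgroup ?K (add_monoid PF)"
    proof (rule subgroup.intro, goal_cases)
      case (2 f g)
      then show ?case
        using PF.a_closed[of f g]
        by (auto simp: PF.r_distr[simplified] PF.l_distr[simplified] cut_add pm.subspace_add)
    next
      case 3 then show ?case using PF.zero_closed by (auto simp: pm.subspace_0)
    next
      case (4 f)
      then have f: "f \<in> carrier PF" by auto
      have "a \<otimes>\<^bsub>PF\<^esub> (\<ominus>\<^bsub>PF\<^esub> f) \<otimes>\<^bsub>PF\<^esub> b = - (a \<otimes>\<^bsub>PF\<^esub> f \<otimes>\<^bsub>PF\<^esub> b)"
        if "a \<in> carrier PF" "b \<in> carrier PF" for a b
        using that f PF_a_inv[of "a \<otimes>\<^bsub>PF\<^esub> f \<otimes>\<^bsub>PF\<^esub> b"] by (simp add: PF.r_minus PF.l_minus)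
      then show ?case unfolding a_inv_def[symmetric] using 4 f by (auto simp: cut_neg pm.subspace_neg)
    qed auto
  next
    fix f x assume f: "f \<in> ?K" and x: "x \<in> carrier PF"
    show "x \<otimes>\<^bsub>PF\<^esub> f \<in> ?K"
    proof (intro CollectI conjI ballI)
      fix a b assume ab: "a \<in> carrier PF" "b \<in> carrier PF"
      have "a \<otimes>\<^bsub>PF\<^esub> (x \<otimes>\<^bsub>PF\<^esub> f) \<otimes>\<^bsub>PF\<^esub> b = (a \<otimes>\<^bsub>PF\<^esub> x) \<otimes>\<^bsub>PF\<^esub> f \<otimes>\<^bsub>PF\<^esub> b"
        using ab f x by (simp add: PF.m_assoc)
      then show "first_cut (a \<otimes>\<^bsub>PF\<^esub> (x \<otimes>\<^bsub>PF\<^esub> f) \<otimes>\<^bsub>PF\<^esub> b) \<in> T" using f ab x by simp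
    qed (use f x in simp)
    show "f \<otimes>\<^bsub>PF\<^esub> x \<in> ?K"
    proof (intro CollectI conjI ballI)
      fix a b assume ab: "a \<in> carrier PF" "b \<in> carrier PF"
      have "a \<otimes>\<^bsub>PF\<^esub> (f \<otimes>\<^bsub>PF\<^esub> x) \<otimes>\<^bsub>PF\<^esub> b = a \<otimes>\<^bsub>PF\<^esub> f \<otimes>\<^bsub>PF\<^esub> (x \<otimes>\<^bsub>PF\<^esub> b)"
        using ab f x by (simp add: PF.m_assoc)
      then show "first_cut (a \<otimes>\<^bsub>PF\<^esub> (f \<otimes>\<^bsub>PF\<^esub> x) \<otimes>\<^bsub>PF\<^esub> b) \<in> T" using f ab x by simp
    qed (use f x in simp)
  qed
  have basis: "first_cut (path_elem \<alpha> \<otimes>\<^bsub>PF\<^esub> path_incl i \<otimes>\<^bsub>PF\<^esub> path_elem \<beta>) \<in> T"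
    if i: "i \<in> I" and \<alpha>: "\<alpha> \<in> paths QF" and \<beta>: "\<beta> \<in> paths QF" for i \<alpha> \<beta>
  proof -
    note ic = I_carrier[OF i]
    consider (new_r) "\<not> list_all isl (snd \<beta>)"
      | (new_l) \<beta>' where "\<beta> = old \<beta>'" "\<not> list_all isl (snd \<alpha>)"
      | (old) \<alpha>' \<beta>' where "\<alpha> = old \<alpha>'" "\<beta> = old \<beta>'"
      using old_or_new[of \<alpha>] old_or_new[of \<beta>] by blast
    then show ?thesis
    proof cases
      case new_r
      let ?f = "path_elem \<alpha> \<otimes>\<^bsub>PF\<^esub> path_incl i"
      have "?f \<otimes>\<^bsub>PF\<^esub> path_elem (from_new \<beta>) \<in> J"
        using incl_J[OF i] \<alpha> cut_paths[OF \<beta>] by (simp add: J.I_l_closed J.I_r_closed)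
      then have "pure [q (?f \<otimes>\<^bsub>PF\<^esub> path_elem (from_new \<beta>)), q (path_elem (before_new \<beta>))] \<in> T"
        using cut_paths[OF \<beta>] by (simp add: q_zero pure_zero)
      from pm.subspace_add[OF tensor_rel_subspace cut_mult_path[OF \<beta> new_r, of ?f] this] show ?thesis
        using \<alpha> ic by simp
    next
      case new_l
      let ?f = "i \<otimes>\<^bsub>PQ\<^esub> path_elem \<beta>'"
      have \<beta>': "\<beta>' \<in> paths Q" using \<beta> new_l by (cases \<beta>') simp
      then have f: "?f \<in> I" using ideal.I_r_closed[OF I i] by simp
      have e: "path_elem \<alpha> \<otimes>\<^bsub>PF\<^esub> path_incl i \<otimes>\<^bsub>PF\<^esub> path_elem \<beta> = path_elem \<alpha> \<otimes>\<^bsub>PF\<^esub> path_incl ?f"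
        using ic \<beta>' \<alpha> \<beta> new_l(1) by (simp add: PF.m_assoc)
      have "path_elem (before_new \<alpha>) \<otimes>\<^bsub>PF\<^esub> path_incl ?f \<in> J"
        using incl_J[OF f] cut_paths[OF \<alpha>] by (simp add: J.I_l_closed)
      then have "pure [q (path_elem (from_new \<alpha>)), q (path_elem (before_new \<alpha>) \<otimes>\<^bsub>PF\<^esub> path_incl ?f)] \<in> T"
        using cut_paths[OF \<alpha>] by (simp add: q_zero pure_zero)
      from pm.subspace_add[OF tensor_rel_subspace cut_path_mult[OF \<alpha> new_l(2) I_carrier[OF f]] this]
      show ?thesis unfolding e by simp
    next
      case old
      have "\<alpha>' \<in> paths Q" "\<beta>' \<in> paths Q" using \<alpha> \<beta> old by (cases \<alpha>'; cases \<beta>'; simp)+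
      then have "path_elem \<alpha> \<otimes>\<^bsub>PF\<^esub> path_incl i \<otimes>\<^bsub>PF\<^esub> path_elem \<beta>
          = path_incl (path_elem \<alpha>' \<otimes>\<^bsub>PQ\<^esub> i \<otimes>\<^bsub>PQ\<^esub> path_elem \<beta>')"
        using ic old by simp
      then show ?thesis by (simp add: cut_incl pm.subspace_0)
    qed
  qed
  have "path_incl ` I \<subseteq> ?K"
  proof (intro image_subsetI CollectI conjI ballI)
    fix i a b assume i: "i \<in> I" and a: "a \<in> carrier PF" and b: "b \<in> carrier PF"
    note ii = incl_closed[OF I_carrier[OF i]]
    show "first_cut (a \<otimes>\<^bsub>PF\<^esub> path_incl i \<otimes>\<^bsub>PF\<^esub> b) \<in> T"
    proof (rule linear_mod_path_algebra[OF tensor_rel_subspace QF.fin_digraph_axioms _ a,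
          of _ _ "\<lambda>a. first_cut (a \<otimes>\<^bsub>PF\<^esub> path_incl i \<otimes>\<^bsub>PF\<^esub> b)"])
      show "linear_mod PF T (\<lambda>a. first_cut (a \<otimes>\<^bsub>PF\<^esub> path_incl i \<otimes>\<^bsub>PF\<^esub> b))"
        by (rule linear_mod_comp[OF PF.mult_hom(2)[OF ii]], rule linear_mod_comp[OF PF.mult_hom(2)[OF b]],
            rule cut_linear, rule tensor_rel_subspace)
      fix \<alpha> assume \<alpha>: "\<alpha> \<in> paths QF"
      show "first_cut (path_elem \<alpha> \<otimes>\<^bsub>PF\<^esub> path_incl i \<otimes>\<^bsub>PF\<^esub> b) \<in> T"
        by (rule linear_mod_path_algebra[OF tensor_rel_subspace QF.fin_digraph_axioms _ b,
          of _ _ "\<lambda>b. first_cut (path_elem \<alpha> \<otimes>\<^bsub>PF\<^esub> path_incl i \<otimes>\<^bsub>PF\<^esub> b)"],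
          rule linear_mod_comp[OF PF.mult_hom(1)])
         (use ii \<alpha> basis[OF i \<alpha>] in \<open>auto intro!: cut_linear\<close>)
    qed
  qed (use I_carrier in auto)
  then have "J \<subseteq> ?K" by (rule J_minimal[OF K])
  moreover assume f: "f \<in> J"
  ultimately have "f \<in> ?K" by (rule subsetD)
  then have "f \<in> carrier PF" and "first_cut (\<one>\<^bsub>PF\<^esub> \<otimes>\<^bsub>PF\<^esub> f \<otimes>\<^bsub>PF\<^esub> \<one>\<^bsub>PF\<^esub>) \<in> T" using PF.one_closed by blast+
  then show "first_cut f \<in> T" by simp
qed

section \<open>The homotopy and the absence of relative cycles\<close>

text \<open>
The map \<open>h\<close> on \<open>B\<^sub>F\<close>.  The choice of \<open>f\<close> matters only up to the relations \<open>T\<close>, by \<open>cut_J\<close>.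
\<close>

definition cut_class :: "(('v, 'e + 'f) path \<Rightarrow>\<^sub>0 'k) set \<Rightarrow> ((('v, 'e + 'f) path \<Rightarrow>\<^sub>0 'k) set list \<Rightarrow>\<^sub>0 'k)" where
  "cut_class X = first_cut (SOME f. f \<in> carrier PF \<and> q f = X)"

lemma cut_class_q:
  assumes f: "f \<in> carrier PF"
  shows "cut_class (q f) - first_cut f \<in> T"
proof -
  define g where "g = (SOME g. g \<in> carrier PF \<and> q g = q f)"
  have g: "g \<in> carrier PF" "q g = q f"
    unfolding g_def using someI[of "\<lambda>g. g \<in> carrier PF \<and> q g = q f" f] f by auto
  have "g - f \<in> J"
    using JS.coset_eq_iff[OF g(1) f] g(2) PF_a_inv[OF f] by (simp add: PF.minus_eq)
  then have "first_cut (g - f) \<in> T" by (rule cut_J)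
  then show ?thesis by (simp add: cut_class_def first_cut_def pm_extend_diff flip: g_def)
qed

lemma cut_class_linear: "linear_mod BF T cut_class"
  unfolding linear_mod_def
proof (intro conjI ballI allI)
  note ss = tensor_rel_subspace[of BF 2]
  have qa: "q f \<oplus>\<^bsub>BF\<^esub> q g = q (f + g)" and qs: "c \<odot>\<^bsub>BF\<^esub> q f = q (pm_scale c f)"
    if "f \<in> carrier PF" "g \<in> carrier PF" for f g c
    using q_ohom that by (simp_all add: operator_hom_def additive_map_def)
  fix X assume X: "X \<in> carrier BF"
  then obtain f where f: "f \<in> carrier PF" "X = q f" by (auto simp: BF_carrier)
  {
    fix Y assume Y: "Y \<in> carrier BF"
    then obtain g where g: "g \<in> carrier PF" "Y = q g" by (auto simp: BF_carrier)
    have fg: "f + g \<in> carrier PF" using PF.a_closed[OF f(1) g(1)] by simp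
    have "cut_class (X \<oplus>\<^bsub>BF\<^esub> Y) - cut_class X - cut_class Y =
        (cut_class (q (f + g)) - first_cut (f + g)) - (cut_class (q f) - first_cut f) - (cut_class (q g) - first_cut g)"
      using f g qa by (simp add: first_cut_def pm_extend_add)
    then show "cut_class (X \<oplus>\<^bsub>BF\<^esub> Y) - cut_class X - cut_class Y \<in> T"
      using cut_class_q[OF fg] cut_class_q[OF f(1)] cut_class_q[OF g(1)]
      by (simp only: pm.subspace_diff[OF ss])
  }
  fix c
  have fc: "pm_scale c f \<in> carrier PF" using PF.smult_closed[OF f(1), of c] by simp
  have "cut_class (c \<odot>\<^bsub>BF\<^esub> X) - pm_scale c (cut_class X) =
      (cut_class (q (pm_scale c f)) - first_cut (pm_scale c f)) - pm_scale c (cut_class (q f) - first_cut f)"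
    using f qs[OF f(1) f(1)] by (simp add: first_cut_def pm_extend_scale pm.scale_right_diff_distrib)
  then show "cut_class (c \<odot>\<^bsub>BF\<^esub> X) - pm_scale c (cut_class X) \<in> T"
    using cut_class_q[OF fc] cut_class_q[OF f(1)]
    by (simp only: pm.subspace_diff[OF ss] pm.subspace_scale[OF ss])
qed

abbreviation "B \<equiv> quiver_algebra Q I"
abbreviation "incl \<equiv> ext_map Q I F sF tF"
abbreviation "retr \<equiv> coset_map PQ I kill_new"

lemma B_algebra: "k_algebra B"
  unfolding quiver_algebra_def by (rule PQ.quotient_k_algebra[OF I])

lemma incl_hom: "algebra_hom B BF incl"
  and incl_coset: "f \<in> carrier PQ \<Longrightarrow> incl (I +>\<^bsub>PQ\<^esub> f) = q (path_incl f)"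
  unfolding quiver_algebra_def ext_algebra_def ext_map_def
  using coset_map_algebra_hom[OF PQ.k_algebra_axioms PF.k_algebra_axioms I J path_incl_hom incl_J] by blast+

lemma retr_hom: "algebra_hom BF B retr"
  and retr_coset: "f \<in> carrier PF \<Longrightarrow> retr (q f) = I +>\<^bsub>PQ\<^esub> kill_new f"
  unfolding quiver_algebra_def ext_algebra_def
  using coset_map_algebra_hom[OF PF.k_algebra_axioms PQ.k_algebra_axioms J I kill_new_hom kill_new_J] by blast+

lemma retr_incl: "b \<in> carrier B \<Longrightarrow> retr (incl b) = b"
proof -
  interpret IS: operator_subgroup I PQ by (rule PQ.ideal_operator_subgroup[OF I])
  show "b \<in> carrier B \<Longrightarrow> retr (incl b) = b"
    unfolding quiver_algebra_def IS.quotient_carrier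
    by (auto simp: incl_coset retr_coset kill_new_incl)
qed

abbreviation "\<rho> \<equiv> \<lambda>X. incl (retr X)"

lemma \<rho>_hom: "algebra_hom BF BF \<rho>"
  by (rule comp_algebra_hom[OF retr_hom incl_hom])

lemma \<rho>_q: "f \<in> carrier PF \<Longrightarrow> \<rho> (q f) = q (path_incl (kill_new f))"
  using algebra_hom_closed[OF kill_new_hom] by (simp add: retr_coset incl_coset)

abbreviation "err \<equiv> BF.homotopy_error \<rho> cut_class"
abbreviation "S \<equiv> BF.bounds1"

lemmas err_linear = BF.homotopy_error_linear[OF \<rho>_hom cut_class_linear]
lemmas err_mult = BF.homotopy_error_mult[OF \<rho>_hom cut_class_linear]

text \<open>
By linearity \<open>X\<close> is a path.  If it has no new arrows, nothing is cut, and \<open>\<rho>\<close> fixes both factors.  If it passes through a new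
arrow and is cut into \<open>x\<close> and \<open>y\<close>, the map \<open>\<rho>\<close> gives \<open>0\<close>, and with \<open>b = q (path_incl g)\<close> the error is,
up to relations, the boundary of \<open>x \<otimes> y \<otimes> b\<close>.
\<close>

lemma err_incl:
  assumes g: "g \<in> carrier PQ" and X: "X \<in> carrier BF"
  shows "err X (q (path_incl g)) \<in> S"
proof -
  note sub = pm.subspace_diff[OF BF.bounds1_subspace] pm.subspace_add[OF BF.bounds1_subspace]
  let ?b = "q (path_incl g)"
  have b: "?b \<in> carrier BF" using g by simp
  have \<rho>b: "\<rho> ?b = ?b" using g by (simp add: \<rho>_q kill_new_incl)
  have TS: "t \<in> T \<Longrightarrow> t \<in> S" for t using BF.rel_bounds1 by blast
  obtain f where f: "f \<in> carrier PF" "X = q f" using X by (auto simp: BF_carrier)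
  have "err (q f) ?b \<in> S"
  proof (rule linear_mod_path_algebra[OF BF.bounds1_subspace QF.fin_digraph_axioms _ f(1), of "\<lambda>f. err (q f) ?b"])
    show "linear_mod PF S (\<lambda>f. err (q f) ?b)"
      by (rule linear_mod_comp[OF q_ohom err_linear(2)[OF b]])
    fix \<alpha> assume \<alpha>: "\<alpha> \<in> paths QF"
    let ?\<alpha> = "path_elem \<alpha> :: ('v, 'e + 'f) path \<Rightarrow>\<^sub>0 'k"
    let ?p = "?\<alpha> \<otimes>\<^bsub>PF\<^esub> path_incl g" and ?r = "path_incl g \<otimes>\<^bsub>PF\<^esub> ?\<alpha>"
    have p: "?p \<in> carrier PF" and r: "?r \<in> carrier PF" using \<alpha> g by simp_all
    show "err (q ?\<alpha>) ?b \<in> S"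
    proof (cases "list_all isl (snd \<alpha>)")
      case True
      then obtain \<alpha>' where \<alpha>': "\<alpha> = old \<alpha>'" using old_or_new by blast
      then have "\<alpha>' \<in> paths Q" using \<alpha> by (cases \<alpha>') simp
      then have a': "path_elem \<alpha>' \<in> carrier PQ" by simp
      have e: "?\<alpha> = path_incl (path_elem \<alpha>')" by (simp add: \<alpha>')
      have "first_cut ?p = 0" "first_cut ?r = 0"
        unfolding e incl_mult[OF a' g, symmetric] incl_mult[OF g a', symmetric] by (rule cut_incl)+
      then have "cut_class (q ?p) \<in> S" "cut_class (q ?r) \<in> S"
        using cut_class_q[OF p] cut_class_q[OF r] TS by simp_all
      moreover have "\<rho> (q ?\<alpha>) = q ?\<alpha>" unfolding e using a' by (simp only: \<rho>_q incl_closed kill_new_incl)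
      moreover have "q ?\<alpha> \<otimes>\<^bsub>BF\<^esub> ?b = q ?p" "?b \<otimes>\<^bsub>BF\<^esub> q ?\<alpha> = q ?r" using \<alpha> g by simp_all
      ultimately show ?thesis
        by (simp add: BF.homotopy_error_def[OF \<rho>_hom cut_class_linear] \<rho>b sub)
    next
      case False
      note cp = cut_paths[OF \<alpha>]
      let ?x = "path_elem (from_new \<alpha>) :: ('v, 'e + 'f) path \<Rightarrow>\<^sub>0 'k"
        and ?y = "path_elem (before_new \<alpha>) :: ('v, 'e + 'f) path \<Rightarrow>\<^sub>0 'k"
      have c: "?x \<in> carrier PF" "?y \<in> carrier PF" "?\<alpha> \<in> carrier PF" using cp \<alpha> by simp_all
      have "kill_new ?\<alpha> = 0" using False by (cases \<alpha>) (simp add: kill_new_elem)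
      then have "\<rho> (q ?\<alpha>) = \<zero>\<^bsub>BF\<^esub>" using \<rho>_q[OF c(3)] by (simp add: path_incl_def q_0)
      then have z: "pure [\<rho> (q ?\<alpha>), \<rho> ?b] \<in> S" using b by (simp add: \<rho>b TS pure_zero)
      define u where "u = cut_class (q ?p) - pure [q ?x, q (?y \<otimes>\<^bsub>PF\<^esub> path_incl g)]"
      define v where "v = cut_class (q ?r) - pure [q (path_incl g \<otimes>\<^bsub>PF\<^esub> ?x), q ?y]"
      have u: "u \<in> S"
      proof -
        have "u = (cut_class (q ?p) - first_cut ?p) + (first_cut ?p - pure [q ?x, q (?y \<otimes>\<^bsub>PF\<^esub> path_incl g)])"
          by (simp add: u_def)
        then show ?thesis
          using sub(2) TS[OF cut_class_q[OF p]] TS[OF cut_path_mult[OF \<alpha> False g]] by metis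
      qed
      have v: "v \<in> S"
      proof -
        have "v = (cut_class (q ?r) - first_cut ?r) + (first_cut ?r - pure [q (path_incl g \<otimes>\<^bsub>PF\<^esub> ?x), q ?y])"
          by (simp add: v_def)
        then show ?thesis
          using sub(2) TS[OF cut_class_q[OF r]] TS[OF cut_mult_path[OF \<alpha> False incl_closed[OF g]]] by metis
      qed
      \<comment> \<open>the boundary of \<open>x \<otimes> y \<otimes> b\<close>\<close>
      have w: "pure [q ?\<alpha>, ?b] - pure [q ?x, q (?y \<otimes>\<^bsub>PF\<^esub> path_incl g)] + pure [q (path_incl g \<otimes>\<^bsub>PF\<^esub> ?x), q ?y] \<in> S"
        using BF.d2_bounds1[of "q ?x" "q ?y" ?b] c g by (simp add: cp(5) del: path_elem_mult)
      have m: "q ?\<alpha> \<otimes>\<^bsub>BF\<^esub> ?b = q ?p" "?b \<otimes>\<^bsub>BF\<^esub> q ?\<alpha> = q ?r" using c g by simp_all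
      have "err (q ?\<alpha>) ?b =
          (pure [q ?\<alpha>, ?b] - pure [q ?x, q (?y \<otimes>\<^bsub>PF\<^esub> path_incl g)] + pure [q (path_incl g \<otimes>\<^bsub>PF\<^esub> ?x), q ?y])
          - pure [\<rho> (q ?\<alpha>), \<rho> ?b] - (u - v)"
        unfolding BF.homotopy_error_def[OF \<rho>_hom cut_class_linear] m u_def v_def by simp
      then show ?thesis using w z u v sub by (simp only:)
    qed
  qed
  then show ?thesis using f by simp
qed

end

locale acyclic_arrow_extension = arrow_extension Q I F sF tF
  for Q :: "('v, 'e) pre_digraph" and I :: "(('v, 'e) path \<Rightarrow>\<^sub>0 'k::field) set"
    and F :: "'f set" and sF tF :: "'f \<Rightarrow> 'v" +
  assumes no_cycle: "\<nexists>as. relative_cycle Q I F sF tF as"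
begin

lemma corner_nonzero:
  assumes p: "(u, p) \<in> paths Q" "path_elem (u, p) \<notin> I"
  shows "corner Q I (path_target Q (u, p)) u \<noteq> {\<zero>\<^bsub>B\<^esub>}"
proof -
  interpret IS: operator_subgroup I PQ by (rule PQ.ideal_operator_subgroup[OF I])
  let ?e = "\<lambda>v. path_elem (v, []) :: ('v, 'e) path \<Rightarrow>\<^sub>0 'k" and ?p = "path_elem (u, p) :: ('v, 'e) path \<Rightarrow>\<^sub>0 'k"
  have c: "?e u \<in> carrier PQ" "?e (path_target Q (u, p)) \<in> carrier PQ" "?p \<in> carrier PQ"
    using p Q.paths_source Q.paths_target by simp_all
  have "?e (path_target Q (u, p)) \<otimes>\<^bsub>PQ\<^esub> ?p \<otimes>\<^bsub>PQ\<^esub> ?e u = ?p"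
    by (simp add: path_mult_def)
  then have "vertex_idem Q I (path_target Q (u, p)) \<otimes>\<^bsub>B\<^esub> (I +>\<^bsub>PQ\<^esub> ?p) \<otimes>\<^bsub>B\<^esub> vertex_idem Q I u = I +>\<^bsub>PQ\<^esub> ?p"
    unfolding vertex_idem_def quiver_algebra_def
    using c PQ.quotient_mult[OF I] by (simp del: path_elem_mult)
  moreover have "I +>\<^bsub>PQ\<^esub> ?p \<in> carrier B"
    unfolding quiver_algebra_def IS.quotient_carrier using c by blast
  ultimately have "I +>\<^bsub>PQ\<^esub> ?p \<in> corner Q I (path_target Q (u, p)) u"
    unfolding corner_def by (metis (mono_tags, lifting) mem_Collect_eq)
  moreover have "I +>\<^bsub>PQ\<^esub> ?p \<noteq> \<zero>\<^bsub>B\<^esub>"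
    unfolding quiver_algebra_def IS.quotient_zero using IS.coset_eq_self_iff[OF c(3)] p by simp
  ultimately show ?thesis by blast
qed

text \<open>
The new arrows met by a path that is nonzero in \<open>B\<^sub>F\<close> are separated by segments of old arrows that are
nonzero in \<open>B\<close>, and such segments witness that the corners required of a relative path are nonzero.
Fixing the arrow \<open>x\<close> in front of the path keeps the list nonempty, so that the induction can start
with a path without new arrows.
\<close>

lemma nonzero_path_relative_path:
  assumes "x \<in> F" "(tF x, p) \<in> paths QF" "path_elem (tF x, p) \<notin> J"
  shows "\<exists>as. relative_path Q I F sF tF (x # as) \<and>
    corner Q I (path_target QF (tF x, p)) (tF (last (x # as))) \<noteq> {\<zero>\<^bsub>B\<^esub>}"
  using assms
proof (induction "length p" arbitrary: x p rule: less_induct)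
  case less
  obtain r where r: "takeWhile isl p = map Inl r"
    using all_old[of "takeWhile isl p"] by (auto simp: list_all_iff dest: set_takeWhileD)
  have pr: "p = map Inl r @ dropWhile isl p" by (simp flip: r)
  have first: "(tF x, r) \<in> paths Q"
    using less.prems(2) QF.paths_append[of "tF x" "map Inl r" "dropWhile isl p"] pr by simp
  have corner_first: "corner Q I (path_target Q (tF x, r)) (tF x) \<noteq> {\<zero>\<^bsub>B\<^esub>}"
    if rn: "path_elem (tF x, map Inl r) \<notin> J"
  proof (rule corner_nonzero[OF first])
    show "path_elem (tF x, r) \<notin> I"
      using rn incl_J[of "path_elem (tF x, r)"] by auto
  qed
  show ?case
  proof (cases "dropWhile isl p")
    case Nil
    then have "p = map Inl r" using pr by (metis append_Nil2)
    then show ?thesis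
      using less.prems corner_first by (intro exI[of _ "[]"]) (simp add: relative_path_def)
  next
    case (Cons e p')
    then have "\<not> isl e" using hd_dropWhile[of isl p] by simp
    then obtain y where y: "e = Inr y" by (cases e) auto
    let ?a = "(tF x, map Inl r)" and ?b = "(sF y, [Inr y]) :: ('v, 'e + 'f) path" and ?c = "(tF y, p')"
    have p: "p = map Inl r @ Inr y # p'" using pr Cons y by simp
    have ps: "(path_target Q (tF x, r), Inr y # p') \<in> paths QF"
      using less.prems(2) QF.paths_append[of "tF x" "map Inl r" "Inr y # p'"] p by simp
    then have yF: "y \<in> F" and t: "path_target Q (tF x, r) = sF y" and c: "?c \<in> paths QF" by auto
    have b: "?b \<in> paths QF" using yF c QF.paths_source by fastforce
    have a: "?a \<in> paths QF" using first by simp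
    have prod: "path_elem ?c \<otimes>\<^bsub>PF\<^esub> (path_elem ?b \<otimes>\<^bsub>PF\<^esub> path_elem ?a) = path_elem (tF x, p)"
      by (simp add: path_mult_def t p path_target_append[of QF "tF x" "map Inl r"])
    have cJ: "path_elem ?c \<notin> J"
    proof
      assume "path_elem ?c \<in> J"
      then have "path_elem ?c \<otimes>\<^bsub>PF\<^esub> (path_elem ?b \<otimes>\<^bsub>PF\<^esub> path_elem ?a) \<in> J"
        using a b by (intro J.I_r_closed PF.m_closed) (simp_all del: path_elem_mult)
      then show False using prod less.prems(3) by simp
    qed
    have aJ: "path_elem ?a \<notin> J"
    proof
      assume "path_elem ?a \<in> J"
      then have "path_elem ?c \<otimes>\<^bsub>PF\<^esub> (path_elem ?b \<otimes>\<^bsub>PF\<^esub> path_elem ?a) \<in> J"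
        using c b by (intro J.I_l_closed) (simp_all del: path_elem_mult)
      then show False using prod less.prems(3) by simp
    qed
    obtain as where as: "relative_path Q I F sF tF (y # as)"
      "corner Q I (path_target QF ?c) (tF (last (y # as))) \<noteq> {\<zero>\<^bsub>B\<^esub>}"
      using less.hyps[of p' y] yF c cJ p by auto
    have "relative_path Q I F sF tF (x # y # as)"
      unfolding relative_path_def
    proof (intro conjI allI impI)
      show "set (x # y # as) \<subseteq> F" using less.prems(1) as(1) by (simp add: relative_path_def)
      fix i assume i: "Suc i < length (x # y # as)"
      show "corner Q I (sF ((x # y # as) ! Suc i)) (tF ((x # y # as) ! i)) \<noteq> {\<zero>\<^bsub>B\<^esub>}"
      proof (cases i)
        case 0 then show ?thesis using corner_first[OF aJ] t by simp
      next
        case (Suc j)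
        have "\<forall>i. Suc i < length (y # as) \<longrightarrow> corner Q I (sF ((y # as) ! Suc i)) (tF ((y # as) ! i)) \<noteq> {\<zero>\<^bsub>B\<^esub>}"
          using as(1) unfolding relative_path_def by blast
        then show ?thesis using i Suc by simp
      qed
    qed simp
    moreover have "path_target QF (tF x, p) = path_target QF ?c"
      by (simp add: p path_target_append[of QF "tF x" "map Inl r"])
    ultimately show ?thesis using as(2) by (intro exI[of _ "y # as"]) simp
  qed
qed

lemma return_path_zero:
  assumes x: "x \<in> F" and \<alpha>: "(tF x, p) \<in> paths QF" "path_target QF (tF x, p) = sF x"
  shows "path_elem (tF x, p) \<in> J"
proof (rule ccontr)
  assume "path_elem (tF x, p) \<notin> J"
  then obtain as where "relative_path Q I F sF tF (x # as)"
     "corner Q I (sF x) (tF (last (x # as))) \<noteq> {\<zero>\<^bsub>B\<^esub>}"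
    using nonzero_path_relative_path[OF x \<alpha>(1)] \<alpha>(2) by auto
  then have "relative_cycle Q I F sF tF (x # as)" by (simp add: relative_cycle_def)
  then show False using no_cycle by blast
qed

text \<open>
With \<open>s\<close>, \<open>t\<close> the vertices at the ends of \<open>x\<close>, write \<open>x\<close> as \<open>t (x s)\<close> and apply \<open>homotopy_error_mult\<close>
twice.  The resulting second factors are the vertices \<open>t\<close> and \<open>s\<close>, covered by \<open>err_incl\<close>, and \<open>x\<close>
itself, whose first factor has become \<open>s X t\<close>; this is a combination of paths
from the target of \<open>x\<close> back to its source, hence \<open>0\<close> by \<open>return_path_zero\<close>.
\<close>

lemma err_new_arrow:
  assumes x: "x \<in> F" and X: "X \<in> carrier BF"
  shows "err X (q (path_elem (sF x, [Inr x]))) \<in> S"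
proof -
  let ?x = "path_elem (sF x, [Inr x]) :: ('v, 'e + 'f) path \<Rightarrow>\<^sub>0 'k"
    and ?s = "path_elem (sF x, []) :: ('v, 'e + 'f) path \<Rightarrow>\<^sub>0 'k"
    and ?t = "path_elem (tF x, []) :: ('v, 'e + 'f) path \<Rightarrow>\<^sub>0 'k"
  have v: "sF x \<in> verts Q" "tF x \<in> verts Q" using x F by (auto simp: new_arrows_def)
  have c: "?x \<in> carrier PF" "?s \<in> carrier PF" "?t \<in> carrier PF" using v x by simp_all
  have vert: "err Y (q (path_elem (u, []))) \<in> S" if "Y \<in> carrier BF" "u \<in> verts Q" for Y u
    using err_incl[of "path_elem (u, [])" Y] that by simp
  have xs: "?x \<otimes>\<^bsub>PF\<^esub> ?s = ?x" and tx: "?t \<otimes>\<^bsub>PF\<^esub> ?x = ?x" by (simp_all add: path_mult_def)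
  have z: "q (?s \<otimes>\<^bsub>PF\<^esub> f \<otimes>\<^bsub>PF\<^esub> ?t) = \<zero>\<^bsub>BF\<^esub>" if f: "f \<in> carrier PF" for f
  proof -
    have "?s \<otimes>\<^bsub>PF\<^esub> f \<otimes>\<^bsub>PF\<^esub> ?t \<in> J"
      using f
    proof (induction rule: path_algebra_induct)
      case zero
      show ?case using J.zero_closed by simp
    next
      case (add f g)
      then show ?case using c J.a_closed
        by (simp add: PF.r_distr[simplified] PF.l_distr[simplified] del: path_elem_mult)
    next
      case (scale r f)
      have "?s \<otimes>\<^bsub>PF\<^esub> pm_scale r f \<otimes>\<^bsub>PF\<^esub> ?t = pm_scale r (?s \<otimes>\<^bsub>PF\<^esub> f \<otimes>\<^bsub>PF\<^esub> ?t)"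
        using PF.smult_mult_right[of ?s f r] PF.smult_mult_left[of "?s \<otimes>\<^bsub>PF\<^esub> f" ?t r] c scale(1)
        by (simp del: path_elem_mult)
      then show ?case using JS.smult_sub[OF scale(2), of r] by simp
    next
      case (path \<alpha>)
      obtain u p where \<alpha>: "\<alpha> = (u, p)" by (cases \<alpha>)
      show ?case
      proof (cases "u = tF x \<and> path_target QF \<alpha> = sF x")
        case True
        then have "?s \<otimes>\<^bsub>PF\<^esub> path_elem \<alpha> \<otimes>\<^bsub>PF\<^esub> ?t = path_elem (tF x, p)"
          by (auto simp: path_mult_def \<alpha>)
        then show ?thesis using return_path_zero[OF x, of p] True path \<alpha> by auto
      next
        case False
        then have "?s \<otimes>\<^bsub>PF\<^esub> path_elem \<alpha> \<otimes>\<^bsub>PF\<^esub> ?t = 0"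
          by (auto simp: path_mult_def \<alpha>)
        then show ?thesis using J.zero_closed by simp
      qed
    qed
    then show ?thesis by (rule q_zero)
  qed
  obtain f where f: "f \<in> carrier PF" "X = q f" using X by (auto simp: BF_carrier)
  have zero: "err \<zero>\<^bsub>BF\<^esub> (q ?x) \<in> S"
    using linear_mod_zero[OF BF.op_group BF.bounds1_subspace err_linear(2)[of "q ?x"]] c by simp
  have "err (q (f \<otimes>\<^bsub>PF\<^esub> ?t)) (q ?x \<otimes>\<^bsub>BF\<^esub> q ?s) \<in> S"
  proof (rule err_mult)
    have "q ?s \<otimes>\<^bsub>BF\<^esub> q (f \<otimes>\<^bsub>PF\<^esub> ?t) = \<zero>\<^bsub>BF\<^esub>"
      using z[OF f(1)] f(1) c by (simp add: PF.m_assoc del: path_elem_mult)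
    then show "err (q ?s \<otimes>\<^bsub>BF\<^esub> q (f \<otimes>\<^bsub>PF\<^esub> ?t)) (q ?x) \<in> S" using zero by simp
    show "err (q (f \<otimes>\<^bsub>PF\<^esub> ?t) \<otimes>\<^bsub>BF\<^esub> q ?x) (q ?s) \<in> S"
      by (rule vert) (use f c v in simp_all)
  qed (use f c in simp_all)
  then have 1: "err (X \<otimes>\<^bsub>BF\<^esub> q ?t) (q ?x) \<in> S"
    using f c xs by (simp del: path_elem_mult)
  have "err X (q ?t \<otimes>\<^bsub>BF\<^esub> q ?x) \<in> S"
  proof (rule err_mult)
    show "err (q ?x \<otimes>\<^bsub>BF\<^esub> X) (q ?t) \<in> S" by (rule vert) (use X c v in simp_all)
  qed (use X c 1 in simp_all)
  then show ?thesis using c tx by (simp del: path_elem_mult)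
qed

lemma err_zero:
  assumes X: "X \<in> carrier BF" and Y: "Y \<in> carrier BF"
  shows "err X Y \<in> S"
proof -
  obtain f where f: "f \<in> carrier PF" "Y = q f" using Y by (auto simp: BF_carrier)
  have basis: "\<forall>X\<in>carrier BF. err X (q (path_elem (u, p))) \<in> S" if "(u, p) \<in> paths QF" for u p
    using that
  proof (induction p arbitrary: u)
    case Nil
    then show ?case using err_incl[of "path_elem (u, [])"] by simp
  next
    case (Cons e p)
    have u: "u \<in> verts Q" using QF.paths_source[OF Cons.prems] by simp
    have p: "(head QF e, p) \<in> paths QF" and e: "(u, [e]) \<in> paths QF"
      using Cons.prems QF.paths_source by auto
    have arrow: "err X (q (path_elem (u, [e]))) \<in> S" if X: "X \<in> carrier BF" for X
    proof (cases e)
      case (Inl a)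
      then have "(u, [a]) \<in> paths Q" using e old_path[of u "[a]"] by simp
      then show ?thesis using err_incl[of "path_elem (u, [a])" X] X Inl by simp
    next
      case (Inr x)
      then show ?thesis using err_new_arrow[of x X] e X by auto
    qed
    have "q (path_elem (u, e # p)) = q (path_elem (head QF e, p)) \<otimes>\<^bsub>BF\<^esub> q (path_elem (u, [e]))"
      using p e by (simp add: path_mult_def del: QF.paths_Cons)
    moreover have "err X (q (path_elem (head QF e, p)) \<otimes>\<^bsub>BF\<^esub> q (path_elem (u, [e]))) \<in> S"
      if X: "X \<in> carrier BF" for X
      by (rule err_mult) (use X p e Cons.IH[OF p] arrow in \<open>simp_all del: QF.paths_Cons\<close>)
    ultimately show ?case by simp
  qed
  have "err X (q f) \<in> S"
    by (rule linear_mod_path_algebra[OF BF.bounds1_subspace QF.fin_digraph_axioms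
        linear_mod_comp[OF q_ohom err_linear(1)[OF X]] f(1)])
      (use basis X in auto)
  then show ?thesis using f by simp
qed

theorem HH1_iso: "HH_map 1 BF incl \<in> linear_iso (HH 1 B) (HH 1 BF)"
proof (rule HH1_retract_iso[OF BF.k_algebra_axioms B_algebra incl_hom retr_hom retr_incl cut_class_linear])
  fix a b assume "a \<in> carrier BF" "b \<in> carrier BF"
  from err_zero[OF this]
  show "pure [a, b] - pure [\<rho> a, \<rho> b] - (cut_class (a \<otimes>\<^bsub>BF\<^esub> b) - cut_class (b \<otimes>\<^bsub>BF\<^esub> a)) \<in> S"
    by (simp add: BF.homotopy_error_def[OF \<rho>_hom cut_class_linear])
qed

end

theorem theorem5p5:
  fixes Q :: "('v, 'e) pre_digraph"
    and I :: "(('v, 'e) path \<Rightarrow>\<^sub>0 'k::field) set"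
    and F :: "'f set" and sF tF :: "'f \<Rightarrow> 'v"
  assumes "fin_digraph Q"
    and "admissible Q I"
    and "new_arrows Q F sF tF"
    and "\<nexists>as. relative_cycle Q I F sF tF as"
  shows "HH_map 1 (ext_algebra Q I F sF tF) (ext_map Q I F sF tF)
    \<in> linear_iso (HH 1 (quiver_algebra Q I)) (HH 1 (ext_algebra Q I F sF tF))"
proof -
  interpret acyclic_arrow_extension Q I F sF tF
    using assms
    by (simp add: acyclic_arrow_extension_def acyclic_arrow_extension_axioms_def
        arrow_extension_def arrow_extension_axioms_def admissible_def)
  show ?thesis by (rule HH1_iso)
qed

end
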